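(* Let $\{c_\lambda\}_{\lambda\in\Lambda} \in \ell^2(\Lambda)$ be a quaternion-valued sequence and let $\mathbf{u}\in\mathbb{H}$. If $$\exp(\pi i x_1)\,\mathbf{u}\,\exp\left(-\pi\left|\mathbf{x}-\left(\tfrac12,\tfrac12\right)\right|^2\right)\exp(\pi j x_2) + \sum_{\lambda=(\mathbf{b},\omega)\in\Lambda} \exp(2\pi i x_1\omega_1)\, c_\lambda\, \exp(-\pi|\mathbf{x}-\mathbf{b}|^2)\exp(2\pi j x_2\omega_2) = 0,$$ where the series converges in $L^2(\mathbb{R}^2,\mathbb{H})$ and the identity holds in $L^2(\mathbb{R}^2,\mathbb{H})$, then $c_\lambda = 0$ for all $\lambda\in\Lambda$.
   Context: $\mathbb{H}$ is the algebra of real quaternions with units $i,j,k$ and modulus $|\cdot|$; $\exp(it)=\cos t+i\sin t$ and $\exp(jt)=\cos t+j\sin t$ for real $t$. The lattice (critical density: cells of volume $1$) is $\Lambda = \{\lambda=(\mathbf{b},\omega) : \mathbf{b},\omega\in\mathbb{Z}^2\}\subset\mathbb{R}^2\times\mathbb{R}^2$. $\ell^2(\Lambda)$ is the space of sequences $c:\Lambda\to\mathbb{H}$ with $\sum_\lambda|c_\lambda|^2<\infty$, and $L^2(\mathbb{R}^2,\mathbb{H})$ is the space of square-integrable $\mathbb{H}$-valued functions. The first summand is the Gabor atom at the additional point $\#$, i.e. $\mathbf{b}=\omega=(1/2,1/2)$, with coefficient $\mathbf{u}$. *)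

theory Defs
  imports "HOL-Analysis.Analysis"
begin

section \<open>The real quaternions\<close>

datatype quat = Quat (qre: real) (qim1: real) (qim2: real) (qim3: real)

lemma quat_eq_iff:
  "p = q \<longleftrightarrow> qre p = qre q \<and> qim1 p = qim1 q \<and> qim2 p = qim2 q \<and> qim3 p = qim3 q"
  by (cases p; cases q) auto

instantiation quat :: ab_group_add
begin

definition "0 = Quat 0 0 0 0"
definition "p + q = Quat (qre p + qre q) (qim1 p + qim1 q) (qim2 p + qim2 q) (qim3 p + qim3 q)"
definition "p - q = Quat (qre p - qre q) (qim1 p - qim1 q) (qim2 p - qim2 q) (qim3 p - qim3 q)"
definition "- p = Quat (- qre p) (- qim1 p) (- qim2 p) (- qim3 p)"

instance
  by standard
    (simp_all add: zero_quat_def plus_quat_def minus_quat_def uminus_quat_def quat_eq_iff)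

end

lemma quat_sel_add [simp]:
  "qre (p + q) = qre p + qre q" "qim1 (p + q) = qim1 p + qim1 q"
  "qim2 (p + q) = qim2 p + qim2 q" "qim3 (p + q) = qim3 p + qim3 q"
  by (simp_all add: plus_quat_def)

lemma quat_sel_diff [simp]:
  "qre (p - q) = qre p - qre q" "qim1 (p - q) = qim1 p - qim1 q"
  "qim2 (p - q) = qim2 p - qim2 q" "qim3 (p - q) = qim3 p - qim3 q"
  by (simp_all add: minus_quat_def)

lemma quat_sel_uminus [simp]:
  "qre (- p) = - qre p" "qim1 (- p) = - qim1 p" "qim2 (- p) = - qim2 p" "qim3 (- p) = - qim3 p"
  by (simp_all add: uminus_quat_def)

lemma quat_sel_zero [simp]: "qre 0 = 0" "qim1 0 = 0" "qim2 0 = 0" "qim3 0 = 0"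
  by (simp_all add: zero_quat_def)

instantiation quat :: ring_1
begin

definition "1 = Quat 1 0 0 0"
definition "p * q = Quat
  (qre p * qre q - qim1 p * qim1 q - qim2 p * qim2 q - qim3 p * qim3 q)
  (qre p * qim1 q + qim1 p * qre q + qim2 p * qim3 q - qim3 p * qim2 q)
  (qre p * qim2 q - qim1 p * qim3 q + qim2 p * qre q + qim3 p * qim1 q)
  (qre p * qim3 q + qim1 p * qim2 q - qim2 p * qim1 q + qim3 p * qre q)"

instance
  by standard (simp_all add: one_quat_def times_quat_def quat_eq_iff algebra_simps)

end

lemma quat_sel_one [simp]: "qre 1 = 1" "qim1 1 = 0" "qim2 1 = 0" "qim3 1 = 0"
  by (simp_all add: one_quat_def)

lemma quat_sel_mult [simp]:
  "qre (p * q) = qre p * qre q - qim1 p * qim1 q - qim2 p * qim2 q - qim3 p * qim3 q"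
  "qim1 (p * q) = qre p * qim1 q + qim1 p * qre q + qim2 p * qim3 q - qim3 p * qim2 q"
  "qim2 (p * q) = qre p * qim2 q - qim1 p * qim3 q + qim2 p * qre q + qim3 p * qim1 q"
  "qim3 (p * q) = qre p * qim3 q + qim1 p * qim2 q - qim2 p * qim1 q + qim3 p * qre q"
  by (simp_all add: times_quat_def)

instantiation quat :: real_algebra_1
begin

definition "r *\<^sub>R q = Quat (r * qre q) (r * qim1 q) (r * qim2 q) (r * qim3 q)"

instance
  by standard (simp_all add: scaleR_quat_def quat_eq_iff algebra_simps)

end

lemma quat_sel_scaleR [simp]:
  "qre (r *\<^sub>R q) = r * qre q" "qim1 (r *\<^sub>R q) = r * qim1 q"
  "qim2 (r *\<^sub>R q) = r * qim2 q" "qim3 (r *\<^sub>R q) = r * qim3 q"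
  by (simp_all add: scaleR_quat_def)

lemma quat_sel_of_real [simp]:
  "qre (of_real r) = r" "qim1 (of_real r) = 0" "qim2 (of_real r) = 0" "qim3 (of_real r) = 0"
  by (simp_all add: of_real_def)

instantiation quat :: real_inner
begin

definition "inner p q = qre p * qre q + qim1 p * qim1 q + qim2 p * qim2 q + qim3 p * qim3 q"
definition "norm q = sqrt ((qre q)\<^sup>2 + (qim1 q)\<^sup>2 + (qim2 q)\<^sup>2 + (qim3 q)\<^sup>2)" for q :: quat
definition "sgn q = q /\<^sub>R norm q" for q :: quat
definition "dist p q = norm (p - q)" for p q :: quat
definition "(uniformity :: (quat \<times> quat) filter) =
  (INF e\<in>{0 <..}. principal {(x, y). dist x y < e})"
definition "open (U :: quat set) \<longleftrightarrow>
  (\<forall>x\<in>U. eventually (\<lambda>(x', y). x' = x \<longrightarrow> y \<in> U) uniformity)"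

instance
proof
  fix p q r :: quat and a :: real
  show "inner p q = inner q p" "inner (p + q) r = inner p r + inner q r"
    "inner (a *\<^sub>R p) q = a * inner p q" "0 \<le> inner p p" "norm p = sqrt (inner p p)"
    by (simp_all add: inner_quat_def norm_quat_def algebra_simps power2_eq_square)
  have "w\<^sup>2 + x\<^sup>2 + y\<^sup>2 + z\<^sup>2 = 0 \<longleftrightarrow> w = 0 \<and> x = 0 \<and> y = 0 \<and> z = 0" for w x y z :: real
    by (simp add: add_nonneg_eq_0_iff)
  then show "inner p p = 0 \<longleftrightarrow> p = 0"
    by (simp add: inner_quat_def quat_eq_iff flip: power2_eq_square)
qed (simp_all only: sgn_quat_def dist_quat_def uniformity_quat_def open_quat_def)

end

instantiation quat :: real_normed_div_algebra
begin

definition "inverse q = Quat (qre q / (norm q)\<^sup>2) (- qim1 q / (norm q)\<^sup>2)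
  (- qim2 q / (norm q)\<^sup>2) (- qim3 q / (norm q)\<^sup>2)"
definition "p div q = p * inverse q" for p q :: quat

instance
proof
  fix p q :: quat
  have n2: "(norm q)\<^sup>2 = qre q * qre q + qim1 q * qim1 q + qim2 q * qim2 q + qim3 q * qim3 q" for q
    by (simp add: norm_quat_def power2_eq_square)
  show "inverse q * q = 1" "q * inverse q = 1" if "q \<noteq> 0"
  proof -
    have "qre q * qre q + qim1 q * qim1 q + qim2 q * qim2 q + qim3 q * qim3 q \<noteq> 0"
      using that n2[of q] by (metis norm_eq_zero power_eq_0_iff)
    then show "inverse q * q = 1" "q * inverse q = 1"
      unfolding inverse_quat_def n2 quat_eq_iff
      by (simp_all add: mult.commute flip: add_divide_distrib diff_divide_distrib)
  qed
  show "p div q = p * inverse q" by (rule divide_quat_def)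
  show "inverse (0 :: quat) = 0" by (simp add: inverse_quat_def quat_eq_iff)
  have "(norm (p * q))\<^sup>2 = (norm p * norm q)\<^sup>2"
    by (simp add: n2 power_mult_distrib algebra_simps)
  then show "norm (p * q) = norm p * norm q"
    by (simp add: power2_eq_iff_nonneg)
qed

end

definition quat_i :: quat where "quat_i = Quat 0 1 0 0"
definition quat_j :: quat where "quat_j = Quat 0 0 1 0"
definition quat_k :: quat where "quat_k = Quat 0 0 0 1"

lemma quat_units_mult:
  "quat_i * quat_i = -1" "quat_j * quat_j = -1" "quat_k * quat_k = -1"
  "quat_i * quat_j = quat_k" "quat_j * quat_k = quat_i" "quat_k * quat_i = quat_j"
  "quat_j * quat_i = - quat_k" "quat_k * quat_j = - quat_i" "quat_i * quat_k = - quat_j"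
  by (simp_all add: quat_eq_iff quat_i_def quat_j_def quat_k_def)

instantiation quat :: euclidean_space
begin

definition "Basis = {1, quat_i, quat_j, quat_k}"

instance
proof
  show "(Basis :: quat set) \<noteq> {}" "finite (Basis :: quat set)"
    by (simp_all add: Basis_quat_def)
  fix u v x :: quat
  show "inner u v = (if u = v then 1 else 0)" if "u \<in> Basis" "v \<in> Basis"
    using that
    by (auto simp: Basis_quat_def inner_quat_def quat_eq_iff quat_i_def quat_j_def quat_k_def)
  show "(\<forall>u\<in>Basis. inner x u = 0) \<longleftrightarrow> x = 0"
    by (simp add: Basis_quat_def inner_quat_def quat_i_def quat_j_def quat_k_def)
      (simp add: quat_eq_iff)
qed

end

definition exp_i :: "real \<Rightarrow> quat"
  where "exp_i t = of_real (cos t) + quat_i * of_real (sin t)"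

definition exp_j :: "real \<Rightarrow> quat"
  where "exp_j t = of_real (cos t) + quat_j * of_real (sin t)"


section \<open>The lattice and square-integrable functions\<close>

definition Lattice :: "((real^2) \<times> (real^2)) set"
  where "Lattice = {(b, \<omega>). (\<forall>m. b $ m \<in> \<int>) \<and> (\<forall>m. \<omega> $ m \<in> \<int>)}"

text \<open>Elements of \<open>L2\<close> are functions rather than classes modulo null sets, so identities in
  \<open>L\<^sup>2\<close> are to be stated almost everywhere.\<close>

definition L2 :: "(real^2 \<Rightarrow> quat) set"
  where "L2 = {f \<in> borel_measurable lebesgue. integrable lebesgue (\<lambda>x. (norm (f x))\<^sup>2)}"

definition L2_norm :: "(real^2 \<Rightarrow> quat) \<Rightarrow> real"
  where "L2_norm f = sqrt (\<integral>x. (norm (f x))\<^sup>2 \<partial>lebesgue)"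

text \<open>Convergence in \<open>L\<^sup>2\<close> of the net of finite partial sums. Membership of the terms and of the
  sum in \<open>L2\<close> is required because \<open>L2_norm\<close> is \<open>0\<close> by convention where the integral does not
  exist.\<close>

definition L2_has_sum :: "('a \<Rightarrow> real^2 \<Rightarrow> quat) \<Rightarrow> (real^2 \<Rightarrow> quat) \<Rightarrow> 'a set \<Rightarrow> bool"
  where "L2_has_sum g f A \<longleftrightarrow> f \<in> L2 \<and> (\<forall>a\<in>A. g a \<in> L2) \<and>
    ((\<lambda>F. L2_norm (\<lambda>x. (\<Sum>a\<in>F. g a x) - f x)) \<longlongrightarrow> 0) (finite_subsets_at_top A)"

end

theory Submission
  imports Defs
begin

text \<open>
  The quaternions carry a left multiplication by \<open>i\<close> and a right multiplication by \<open>j\<close>, which commute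
  and have the square \<open>-1\<close>. They are diagonalised simultaneously by two complex-valued functionals,
  under which \<open>exp (i s) q exp (j t)\<close> becomes \<open>cis (s \<plusminus> t)\<close> times the image of \<open>q\<close>
  (\<open>bimodule_proj_exp\<close>), and a quaternion killed by both is zero. So it suffices to treat complex
  coefficients, and there the atoms are tensor products of Gaussian atoms on the line.

  On the line, at critical density, the Gaussian atoms have a biorthogonal system, the shifts of
  Bastiaans' window. It follows from the vanishing of an alternating sum of Gaussians
  (\<open>tail_coeff_biorthogonal\<close>), that is, from the zero of the theta function. The window is not square integrable, because the Zak transform of the
  Gaussian vanishes at the centre of the time-frequency cell; but it becomes so when it is multiplied
  by a function of period \<open>1\<close> that vanishes near the half-integers. Pairing the given identity
  with such functions (\<open>dual_test2\<close>) leaves, for each translation \<open>\<beta>\<close>, a relation between the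
  coefficients \<open>c (\<beta>, \<omega>)\<close> over this \<open>\<beta>\<close>, the Fourier coefficients of the periodic factors, and the
  pairing of the extra atom with the test function.

  The extra point sits exactly where the Zak transform vanishes. Therefore its atom has expansion
  coefficients too large for \<open>\<ell>\<^sup>2\<close>: testing near the half-integers, at a distance of order \<open>1/\<beta>\<close>,
  shows that the coefficients over \<open>\<beta>\<close> would have squared norm at least a multiple of
  \<open>\<bar>v\<bar>\<^sup>2/\<beta>\<close>, where \<open>v\<close> is the image of \<open>u\<close> (\<open>extra_pairing_boundary\<close>), and the harmonic
  series diverges. Hence the extra atom is absent, and the same relations, with periodic factors that exhaust the cell, give that all coefficients vanish
  (\<open>scalar_uniqueness\<close>). Both steps combine Bessel's inequality with the Cauchy--Schwarz
  inequality.
\<close>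

section \<open>Alternating Gaussian tails\<close>

text \<open>The tail from index \<open>m\<close> of the alternating series of the \<open>(-1)^n exp (-\<pi>(n + 1/2)\<^sup>2)\<close>,
  multiplied by \<open>(-1)^m\<close> so that it is nonnegative.\<close>

definition alt_gauss_tail :: "nat \<Rightarrow> real"
  where "alt_gauss_tail m = (\<Sum>n. (-1)^n * exp (- pi * (real n + real m + 1/2)\<^sup>2))"

lemma alt_gauss_tail_summable: "summable (\<lambda>n. (-1)^n * exp (- pi * (real n + real m + 1/2)\<^sup>2))"
  and alt_gauss_tail_nonneg: "0 \<le> alt_gauss_tail m"
proof -
  have mono: "exp (- pi * (real (Suc n) + real m + 1/2)\<^sup>2) \<le> exp (- pi * (real n + real m + 1/2)\<^sup>2)" for n
    by (simp add: power_mono)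
  have lim: "(\<lambda>n. exp (- pi * (real n + real m + 1/2)\<^sup>2)) \<longlonglongrightarrow> 0"
    by real_asymp
  note L = summable_Leibniz'[OF lim _ mono, simplified]
  show "summable (\<lambda>n. (-1)^n * exp (- pi * (real n + real m + 1/2)\<^sup>2))"
    using L(1) by simp
  show "0 \<le> alt_gauss_tail m"
    using L(2)[of 0] by (simp add: alt_gauss_tail_def)
qed

lemma alt_gauss_tail_rec: "alt_gauss_tail m + alt_gauss_tail (Suc m) = exp (- pi * (real m + 1/2)\<^sup>2)"
proof -
  have "alt_gauss_tail m - exp (- pi * (real m + 1/2)\<^sup>2) = (\<Sum>n. (-1)^Suc n * exp (- pi * (real (Suc n) + real m + 1/2)\<^sup>2))"
    using suminf_split_head[OF alt_gauss_tail_summable[of m]] by (simp add: alt_gauss_tail_def)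
  also have "\<dots> = (\<Sum>n. - ((-1)^n * exp (- pi * (real n + real (Suc m) + 1/2)\<^sup>2)))"
    by (simp add: algebra_simps)
  also have "\<dots> = - alt_gauss_tail (Suc m)"
    using suminf_minus[OF alt_gauss_tail_summable[of "Suc m"]] by (simp add: alt_gauss_tail_def)
  finally show ?thesis by simp
qed

lemma alt_gauss_tail_le: "alt_gauss_tail m \<le> exp (- pi * (real m + 1/2)\<^sup>2)"
  using alt_gauss_tail_rec[of m] alt_gauss_tail_nonneg[of "Suc m"] by simp

lemma alt_gauss_tail_ge: "exp (- pi * (real m + 1/2)\<^sup>2) - exp (- pi * (real m + 3/2)\<^sup>2) \<le> alt_gauss_tail m"
  using alt_gauss_tail_rec[of m] alt_gauss_tail_le[of "Suc m"] by (simp add: algebra_simps)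

text \<open>Within a tail the first term dominates, since the Gaussian at the next half-integer is smaller
  by the factor \<open>exp (-\<pi>(2m + 2))\<close>.\<close>

lemma alt_gauss_tail_half: "exp (- pi * (real m + 1/2)\<^sup>2) / 2 \<le> alt_gauss_tail m"
proof -
  have "(real m + 3/2)\<^sup>2 = (real m + 1/2)\<^sup>2 + (2 * real m + 2)"
    by (simp add: power2_eq_square algebra_simps)
  then have e: "exp (- pi * (real m + 3/2)\<^sup>2) = exp (- pi * (real m + 1/2)\<^sup>2) * exp (- pi * (2 * real m + 2))"
    by (simp only: distrib_left exp_add)
  have "1 * 1 \<le> pi * (2 * real m + 2)"
    using pi_gt3 by (intro mult_mono) auto
  then have "2 \<le> exp (pi * (2 * real m + 2))"
    using exp_ge_add_one_self[of "pi * (2 * real m + 2)"] by linarith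
  then have "inverse (exp (pi * (2 * real m + 2))) \<le> inverse 2"
    by (rule le_imp_inverse_le) simp
  then have "exp (- pi * (2 * real m + 2)) \<le> 1/2"
    by (simp only: exp_minus[symmetric] mult_minus_left) simp
  then have "exp (- pi * (real m + 1/2)\<^sup>2) * exp (- pi * (2 * real m + 2)) \<le> exp (- pi * (real m + 1/2)\<^sup>2) * (1/2)"
    by (intro mult_left_mono) auto
  with alt_gauss_tail_ge[of m] e show ?thesis by linarith
qed

section \<open>Summation over the integers and biorthogonality\<close>

lemma has_sum_geometric_int:
  fixes z :: real
  assumes "0 \<le> z" "z < 1"
  shows "((\<lambda>k::int. z ^ nat \<bar>k\<bar>) has_sum (2 * (z / (1 - z)))) (UNIV - {0})"
proof -
  have geo: "((\<lambda>n. z ^ n) has_sum (z / (1 - z))) {1..}"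
    using assms by (intro has_sum_geometric_from_1) auto
  have "bij_betw int {1..} {1..}"
    by (rule bij_betw_byWitness[where f' = nat]) auto
  from has_sum_reindex_bij_betw[OF this, of "\<lambda>k. z ^ nat \<bar>k\<bar>"] geo
  have pos: "((\<lambda>k::int. z ^ nat \<bar>k\<bar>) has_sum (z / (1 - z))) {1..}" by simp
  have "bij_betw (\<lambda>n. - int n) {1..} {..-1}"
    by (rule bij_betw_byWitness[where f' = "\<lambda>k. nat (- k)"]) auto
  from has_sum_reindex_bij_betw[OF this, of "\<lambda>k. z ^ nat \<bar>k\<bar>"] geo
  have neg: "((\<lambda>k::int. z ^ nat \<bar>k\<bar>) has_sum (z / (1 - z))) {..-1}" by simp
  have "UNIV - {0} = {1..} \<union> {..-1::int}" by auto
  moreover have "{1..} \<inter> {..-1::int} = {}" by auto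
  ultimately show ?thesis using has_sum_Un_disjoint[OF pos neg] by simp
qed

lemma summable_on_exp_abs_int:
  assumes "a > 0"
  shows "(\<lambda>k::int. exp (- a * \<bar>real_of_int k\<bar>)) summable_on UNIV"
proof -
  have "exp (- a * \<bar>real_of_int k\<bar>) = exp (- a) ^ nat \<bar>k\<bar>" for k
    using exp_of_nat2_mult[of "- a" "nat \<bar>k\<bar>"] by simp
  moreover have "(\<lambda>k::int. exp (- a) ^ nat \<bar>k\<bar>) summable_on insert 0 (UNIV - {0})"
    unfolding summable_on_insert_iff
    by (rule has_sum_imp_summable, rule has_sum_geometric_int) (use assms in auto)
  ultimately show ?thesis by (simp add: insert_absorb)
qed

text \<open>Completing the square compares the Gaussian weights with a geometric sequence.\<close>

lemma summable_on_exp_quadratic_int: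
  "(\<lambda>k::int. exp (c * \<bar>real_of_int k\<bar> - pi * (real_of_int k)\<^sup>2)) summable_on UNIV"
proof (rule summable_on_comparison_test)
  show "(\<lambda>k::int. exp ((c+1)\<^sup>2 / (4*pi)) * exp (- 1 * \<bar>real_of_int k\<bar>)) summable_on UNIV"
    by (intro summable_on_cmult_right summable_on_exp_abs_int) simp
next
  fix k :: int
  have "0 \<le> (pi * \<bar>real_of_int k\<bar> - (c+1)/2)\<^sup>2 / pi" by simp
  also have "\<dots> = pi * (real_of_int k)\<^sup>2 - (c+1) * \<bar>real_of_int k\<bar> + (c+1)\<^sup>2 / (4*pi)"
    by (simp add: field_simps power2_eq_square)
  finally show "exp (c * \<bar>real_of_int k\<bar> - pi * (real_of_int k)\<^sup>2)
      \<le> exp ((c+1)\<^sup>2 / (4*pi)) * exp (- 1 * \<bar>real_of_int k\<bar>)"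
    by (simp add: algebra_simps flip: exp_add)
qed auto

text \<open>The signed tail from index \<open>\<bar>k\<bar>\<close>: these numbers are the values of Bastiaans' dual window on
  the cells of the line, up to the factor \<open>exp (\<pi>x\<^sup>2)\<close>.\<close>

definition tail_coeff :: "int \<Rightarrow> real"
  where "tail_coeff k = (-1) ^ nat \<bar>k\<bar> * alt_gauss_tail (nat \<bar>k\<bar>)"

lemma abs_tail_coeff: "\<bar>tail_coeff k\<bar> = alt_gauss_tail (nat \<bar>k\<bar>)"
  by (simp add: tail_coeff_def abs_mult alt_gauss_tail_nonneg)

lemma abs_tail_coeff_le: "\<bar>tail_coeff k\<bar> \<le> exp (- pi * (\<bar>real_of_int k\<bar> + 1/2)\<^sup>2)"
  using alt_gauss_tail_le[of "nat \<bar>k\<bar>"] by (simp add: abs_tail_coeff)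

text \<open>Consecutive tails differ by a single term. One formula covers both signs of \<open>k\<close> because the
  Gaussian takes equal values at opposite half-integers.\<close>

lemma tail_coeff_diff:
  "tail_coeff (k - 1) - tail_coeff k = - ((-1) ^ nat \<bar>k\<bar> * exp (- pi * (real_of_int k - 1/2)\<^sup>2))"
proof (cases "k \<ge> 1")
  case True
  then obtain n where n: "k = int (Suc n)" by (intro that[of "nat (k - 1)"]) simp
  have "nat (1 + int n) = Suc n" by simp
  moreover have "real_of_int (int (Suc n)) - 1/2 = real n + 1/2" by simp
  ultimately show ?thesis
    unfolding n tail_coeff_def using alt_gauss_tail_rec[of n]
    by (simp flip: distrib_left)
next
  case False
  then obtain n where n: "k = - int n" by (intro that[of "nat (- k)"]) simp
  have "nat \<bar>- int n - 1\<bar> = Suc n" by simp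
  moreover have "(real_of_int (- int n) - 1/2)\<^sup>2 = (real n + 1/2)\<^sup>2"
    by (simp add: power2_eq_square algebra_simps)
  moreover have "(-1) ^ n * alt_gauss_tail n + (-1) ^ n * alt_gauss_tail (Suc n) = (-1) ^ n * exp (- pi * (real n + 1/2)\<^sup>2)"
    using alt_gauss_tail_rec[of n] by (simp flip: distrib_left)
  ultimately show ?thesis
    unfolding n tail_coeff_def by simp
qed

lemma abs_summable_exp_tail_coeff:
  "(\<lambda>k. exp (2 * pi * t * real_of_int k) * \<bar>tail_coeff k\<bar>) summable_on UNIV"
proof (rule summable_on_comparison_test)
  show "(\<lambda>k::int. exp ((2 * pi * \<bar>t\<bar>) * \<bar>real_of_int k\<bar> - pi * (real_of_int k)\<^sup>2)) summable_on UNIV"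
    by (rule summable_on_exp_quadratic_int)
next
  fix k :: int
  have "exp (2 * pi * t * real_of_int k) * \<bar>tail_coeff k\<bar>
      \<le> exp (2 * pi * t * real_of_int k) * exp (- pi * (\<bar>real_of_int k\<bar> + 1/2)\<^sup>2)"
    by (intro mult_left_mono abs_tail_coeff_le) auto
  also have "\<dots> \<le> exp ((2 * pi * \<bar>t\<bar>) * \<bar>real_of_int k\<bar>) * exp (- pi * (real_of_int k)\<^sup>2)"
  proof (intro mult_mono)
    have "t * real_of_int k \<le> \<bar>t\<bar> * \<bar>real_of_int k\<bar>"
      by (metis abs_ge_self abs_mult)
    then show "exp (2 * pi * t * real_of_int k) \<le> exp ((2 * pi * \<bar>t\<bar>) * \<bar>real_of_int k\<bar>)"
      by (simp add: mult.assoc)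
    have "(real_of_int k)\<^sup>2 \<le> (\<bar>real_of_int k\<bar> + 1/2)\<^sup>2"
      by (simp add: power2_eq_square algebra_simps)
    then show "exp (- pi * (\<bar>real_of_int k\<bar> + 1/2)\<^sup>2) \<le> exp (- pi * (real_of_int k)\<^sup>2)" by simp
  qed auto
  finally show "exp (2 * pi * t * real_of_int k) * \<bar>tail_coeff k\<bar>
      \<le> exp ((2 * pi * \<bar>t\<bar>) * \<bar>real_of_int k\<bar> - pi * (real_of_int k)\<^sup>2)"
    by (simp add: exp_diff exp_minus field_simps)
qed auto

text \<open>This is the biorthogonality of Bastiaans' window to the Gaussian shifted by a nonzero integer
  \<open>d\<close>. Multiplying the sum by \<open>exp (2\<pi>d) - 1\<close> turns it, by summation by parts and by completing
  the square, into the alternating sum of the \<open>exp (-\<pi>(k - 1/2 - d)\<^sup>2)\<close>, which vanishes because the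
  reflection of \<open>k\<close> in the centre of the Gaussian changes the parity of \<open>k\<close>. In other words, the theta
  function vanishes at its half-period.\<close>

lemma tail_coeff_biorthogonal:
  fixes d :: int
  assumes "d \<noteq> 0"
  shows "((\<lambda>k. exp (2 * pi * d * real_of_int k) * tail_coeff k) has_sum 0) UNIV"
proof -
  let ?f = "\<lambda>k. exp (2 * pi * d * real_of_int k) * tail_coeff k"
  let ?g = "\<lambda>k::int. (-1) ^ nat \<bar>k\<bar> * exp (- pi * (real_of_int k - 1/2 - d)\<^sup>2)"
  let ?c = "exp (pi * ((d + 1/2)\<^sup>2 - 1/4)) :: real"
  have "(\<lambda>k. norm (?f k)) summable_on UNIV"
    using abs_summable_exp_tail_coeff[of d] by (simp add: abs_mult)
  then have "?f summable_on UNIV" by (rule abs_summable_summable)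
  then obtain Z where Z: "(?f has_sum Z) UNIV" by (meson summable_iff_has_sum_infsum)
  \<comment> \<open>Summation by parts: the sum is compared with its shift.\<close>
  have "((\<lambda>k. ?f (k - 1)) has_sum Z) UNIV"
    by (subst has_sum_reindex_bij_betw[where f = ?f and g = "\<lambda>k. k - 1" and B = UNIV])
       (auto intro!: bij_betwI[where g = "\<lambda>k. k + 1"] Z)
  then have "((\<lambda>k. exp (2*pi*d) * ?f (k - 1)) has_sum (exp (2*pi*d) * Z)) UNIV"
    by (rule has_sum_cmult_right)
  from has_sum_add[OF this has_sum_uminusI[OF Z]]
  have D: "((\<lambda>k. exp (2*pi*d) * ?f (k - 1) - ?f k) has_sum (exp (2*pi*d) - 1) * Z) UNIV"
    by (simp add: algebra_simps)
  have E: "exp (2*pi*d) * ?f (k - 1) - ?f k = - ?c * ?g k" for k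
  proof -
    have "exp (2*pi*d) * ?f (k - 1) - ?f k = exp (2 * pi * d * real_of_int k) * (tail_coeff (k - 1) - tail_coeff k)"
      by (simp add: algebra_simps flip: exp_add)
    also have "\<dots> = - ((-1) ^ nat \<bar>k\<bar> * exp (2 * pi * d * real_of_int k + - pi * (real_of_int k - 1/2)\<^sup>2))"
      unfolding tail_coeff_diff exp_add by simp
    also have "2 * pi * d * real_of_int k + - pi * (real_of_int k - 1/2)\<^sup>2
        = pi * ((d + 1/2)\<^sup>2 - 1/4) + - pi * (real_of_int k - 1/2 - d)\<^sup>2"
      by (simp add: power2_eq_square algebra_simps)
    finally show ?thesis unfolding exp_add by simp
  qed
  have G: "((\<lambda>k. - ?c * ?g k) has_sum (exp (2*pi*d) - 1) * Z) UNIV"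
    using D unfolding E .
  \<comment> \<open>The reflection about \<open>d + 1/2\<close> is odd on the alternating Gaussians.\<close>
  have "((\<lambda>k. - ?c * ?g (2 * d + 1 - k)) has_sum (exp (2*pi*d) - 1) * Z) UNIV"
    by (rule iffD2[OF has_sum_reindex_bij_betw[where f = "\<lambda>k. - ?c * ?g k"] G])
       (auto intro!: bij_betwI[where g = "\<lambda>k. 2 * d + 1 - k"])
  moreover have "?g (2 * d + 1 - k) = - ?g k" for k
  proof -
    have "(real_of_int (2 * d + 1 - k) - 1/2 - d)\<^sup>2 = (real_of_int k - 1/2 - d)\<^sup>2"
      by (simp add: power2_eq_square algebra_simps)
    moreover have "(-1::real) ^ nat \<bar>2 * d + 1 - k\<bar> = - ((-1) ^ nat \<bar>k\<bar>)"
      by (cases "even k") (auto simp: minus_one_power_iff even_nat_iff)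
    ultimately show ?thesis by simp
  qed
  ultimately have "((\<lambda>k. - (- ?c * ?g k)) has_sum (exp (2*pi*d) - 1) * Z) UNIV" by simp
  then have "((\<lambda>k. - ?c * ?g k) has_sum - ((exp (2*pi*d) - 1) * Z)) UNIV"
    by (subst (asm) has_sum_uminus) 
  with G have "(exp (2*pi*d) - 1) * Z = - ((exp (2*pi*d) - 1) * Z)" by (rule has_sum_unique)
  then have "(exp (2*pi*d) - 1) * Z = 0" by simp
  with assms have "Z = 0" by simp
  with Z show ?thesis by simp
qed


text \<open>The normalisation of the biorthogonality must not vanish. Regrouping the tails, the total is the
  sum of the \<open>(-1)^n (2n + 1) exp (-\<pi>(n + 1/2)\<^sup>2)\<close>, so this says that the zero of the theta function
  is simple; numerically, the coefficient at \<open>0\<close> outweighs all the others together.\<close>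

lemma tail_coeff_total_pos: "\<exists>K>0. (tail_coeff has_sum K) UNIV"
proof -
  define x where "x = exp (- 2 * pi)"
  define q where "q = exp (- pi / 4)"
  have "3 < pi" by (rule pi_gt3)
  have "x * (1 + 2 * pi) \<le> x * exp (2 * pi)"
    unfolding x_def by (intro mult_left_mono exp_ge_add_one_self) auto
  also have "\<dots> = 1" by (simp add: x_def flip: exp_add)
  finally have "x * (1 + 2 * pi) \<le> 1" .
  moreover have "x * 7 \<le> x * (1 + 2 * pi)" 
    using \<open>3 < pi\<close> by (intro mult_left_mono) (auto simp: x_def)
  ultimately have "x \<le> 1/7" by simp
  moreover have "0 < x" by (simp add: x_def)
  ultimately have x: "0 < x" "x \<le> 1/7" by auto
  have bound: "\<bar>tail_coeff k\<bar> \<le> q * x ^ nat \<bar>k\<bar>" for k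
  proof -
    have "\<bar>k\<bar> * 1 \<le> \<bar>k\<bar> * \<bar>k\<bar>"
    proof (cases "k = 0")
      case False
      then show ?thesis by (intro mult_left_mono) linarith+
    qed simp
    then have "real_of_int (\<bar>k\<bar> * 1) \<le> real_of_int (\<bar>k\<bar> * \<bar>k\<bar>)" by (simp only: of_int_le_iff)
    then have "\<bar>real_of_int k\<bar> * 2 + 1/4 \<le> (\<bar>real_of_int k\<bar> + 1/2)\<^sup>2"
      by (simp add: power2_eq_square algebra_simps)
    then have "pi * (\<bar>real_of_int k\<bar> * 2 + 1/4) \<le> pi * (\<bar>real_of_int k\<bar> + 1/2)\<^sup>2"
      by (intro mult_left_mono) auto
    then have "exp (- pi * (\<bar>real_of_int k\<bar> + 1/2)\<^sup>2) \<le> exp (- pi / 4 + (- 2 * pi) * \<bar>real_of_int k\<bar>)"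
      by (simp add: algebra_simps)
    also have "\<dots> = q * x ^ nat \<bar>k\<bar>"
      using exp_of_nat2_mult[of "- 2 * pi" "nat \<bar>k\<bar>"]
      by (simp only: exp_add) (simp add: q_def x_def)
    finally show ?thesis using abs_tail_coeff_le[of k] by simp
  qed
  have G: "((\<lambda>k. q * x ^ nat \<bar>k\<bar>) has_sum (q * (2 * (x / (1 - x))))) (UNIV - {0})"
    using x by (intro has_sum_cmult_right has_sum_geometric_int) auto
  have "(\<lambda>k. norm (tail_coeff k)) summable_on UNIV - {0}"
    by (rule summable_on_comparison_test[OF has_sum_imp_summable[OF G]]) (use bound in auto)
  then obtain T where T: "(tail_coeff has_sum T) (UNIV - {0})"
    using abs_summable_summable summable_iff_has_sum_infsum by blast
  have "\<bar>T\<bar> \<le> q * (2 * (x / (1 - x)))"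
    using norm_infsum_le[OF T G] bound by simp
  also have "2 * (x / (1 - x)) \<le> 1/3"
    using x by (simp add: field_simps)
  finally have T3: "\<bar>T\<bar> \<le> q / 3" by (simp add: q_def)
  have "exp (- pi * (real 0 + 3/2)\<^sup>2) = q * x"
    by (simp add: q_def x_def power2_eq_square flip: exp_add)
  moreover have "exp (- pi * (real 0 + 1/2)\<^sup>2) = q"
    by (simp add: q_def power2_eq_square)
  ultimately have "tail_coeff 0 \<ge> q * (1 - x)"
    using alt_gauss_tail_ge[of 0] by (simp add: tail_coeff_def algebra_simps)
  moreover have "q * (1 - x) \<ge> q * (6/7)"
    using x by (intro mult_left_mono) (auto simp: q_def)
  moreover have "q > 0" by (simp add: q_def)
  ultimately have "tail_coeff 0 + T > 0" using T3 by linarith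
  moreover have "(tail_coeff has_sum (tail_coeff 0 + T)) (insert 0 (UNIV - {0}))"
    using T by (intro has_sum_insert) auto
  ultimately show ?thesis by (auto simp: insert_absorb)
qed

section \<open>Integration by unit cells\<close>

lemma round_add_int:
  fixes y :: real
  assumes "- 1/2 \<le> y" "y < 1/2"
  shows "round (y + of_int k) = k"
  using assms by (simp add: round_def floor_eq_iff)

text \<open>The line is the disjoint union of the cells \<open>[k - 1/2, k + 1/2)\<close>, whose points are those that round
  to \<open>k\<close>. A summable bound on the cells gives integrability and the value of the integral at once.\<close>

lemma integral_tiling:
  fixes f :: "real \<Rightarrow> 'a::{banach, second_countable_topology}"
  assumes [measurable]: "f \<in> borel_measurable borel"
    and M: "M summable_on (UNIV :: int set)"
    and bound: "\<And>k y. - 1/2 \<le> y \<Longrightarrow> y < 1/2 \<Longrightarrow> norm (f (y + of_int k)) \<le> M k"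
  shows integrable_tiling: "integrable lborel f"
    and has_sum_tiling:
      "((\<lambda>k. \<integral>y. indicator {-1/2..<1/2} y *\<^sub>R f (y + of_int k) \<partial>lborel) has_sum (\<integral>x. f x \<partial>lborel)) UNIV"
proof -
  define I where "I k = {of_int k - 1/2..<of_int k + 1/2 :: real}" for k :: int
  define g where "g n x = indicator (I (int_decode n)) x *\<^sub>R f x" for n x
  have mem: "x \<in> I k \<longleftrightarrow> round x = k" for x k
    by (auto simp: I_def round_def floor_eq_iff)
  have gz: "g n x = 0" if "n \<noteq> int_encode (round x)" for n x
    using that mem[of x "int_decode n"] by (auto simp: g_def)
  have sup: "g n x = (if n = int_encode (round x) then f x else 0)" for n x
    using mem[of x "int_decode n"] by (auto simp: g_def)
  have gb: "norm (g n x) \<le> indicator (I (int_decode n)) x * M (int_decode n)" for n x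
  proof (cases "x \<in> I (int_decode n)")
    case True
    then show ?thesis
      using bound[of "x - of_int (int_decode n)" "int_decode n"] by (auto simp: g_def I_def)
  qed (simp add: g_def)
  have [measurable]: "g n \<in> borel_measurable borel" for n
    unfolding g_def I_def by measurable
  have indint: "integrable lborel (\<lambda>x. indicator (I k) x * M k)" for k
    unfolding I_def by (intro integrable_mult_left) simp
  have gi: "integrable lborel (g n)" for n
    by (rule Bochner_Integration.integrable_bound[OF indint[of "int_decode n"]])
       (use gb in \<open>auto intro: order_trans[OF _ abs_ge_self]\<close>)
  have gn: "(\<integral>x. norm (g n x) \<partial>lborel) \<le> M (int_decode n)" for n
  proof -
    have "(\<integral>x. norm (g n x) \<partial>lborel) \<le> (\<integral>x. indicator (I (int_decode n)) x * M (int_decode n) \<partial>lborel)"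
      by (intro integral_mono integrable_norm gi indint gb)
    also have "\<dots> = M (int_decode n)" by (simp add: I_def)
    finally show ?thesis .
  qed
  have bij: "bij_betw int_decode UNIV UNIV" by (rule bij_int_decode)
  have "(\<lambda>n. M (int_decode n)) summable_on UNIV"
    using M by (subst summable_on_reindex_bij_betw[OF bij])
  then have Ms: "summable (\<lambda>n. M (int_decode n))" by (rule summable_on_imp_summable)
  have s1: "AE x in lborel. summable (\<lambda>n. norm (g n x))"
  proof (rule AE_I2)
    fix x
    show "summable (\<lambda>n. norm (g n x))"
      by (rule summable_finite[of "{int_encode (round x)}"]) (auto simp: gz)
  qed
  have s2: "summable (\<lambda>n. \<integral>x. norm (g n x) \<partial>lborel)"
    by (rule summable_comparison_test'[OF Ms]) (use gn in auto)
  have f: "(\<Sum>n. g n x) = f x" for x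
    by (subst suminf_finite[of "{int_encode (round x)}"]) (auto simp: sup)
  show "integrable lborel f"
    using integrable_suminf[OF gi s1 s2] by (simp add: f)
  have "(\<lambda>n. \<integral>x. g n x \<partial>lborel) sums (\<integral>x. f x \<partial>lborel)"
    using sums_integral[OF gi s1 s2] by (simp add: f)
  moreover have "summable (\<lambda>n. norm (\<integral>x. g n x \<partial>lborel))"
    by (rule summable_comparison_test'[OF s2]) (auto intro: integral_norm_bound)
  ultimately have "((\<lambda>n. \<integral>x. g n x \<partial>lborel) has_sum (\<integral>x. f x \<partial>lborel)) UNIV"
    by (intro norm_summable_imp_has_sum)
  then have "((\<lambda>n. (\<lambda>k. \<integral>x. indicator (I k) x *\<^sub>R f x \<partial>lborel) (int_decode n)) has_sum (\<integral>x. f x \<partial>lborel)) UNIV"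
    by (simp add: g_def)
  then have "((\<lambda>k. \<integral>x. indicator (I k) x *\<^sub>R f x \<partial>lborel) has_sum (\<integral>x. f x \<partial>lborel)) UNIV"
    by (subst (asm) has_sum_reindex_bij_betw[OF bij])
  moreover have "(\<integral>x. indicator (I k) x *\<^sub>R f x \<partial>lborel)
      = (\<integral>y. indicator {-1/2..<1/2} y *\<^sub>R f (y + of_int k) \<partial>lborel)" for k
    by (subst lborel_integral_real_affine[where c = 1 and t = "of_int k"])
       (auto simp: I_def add.commute indicator_def intro!: Bochner_Integration.integral_cong)
  ultimately show "((\<lambda>k. \<integral>y. indicator {-1/2..<1/2} y *\<^sub>R f (y + of_int k) \<partial>lborel) has_sum (\<integral>x. f x \<partial>lborel)) UNIV"
    by simp
qed

section \<open>The dual window and its pairing with Gaussian atoms\<close>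

text \<open>Bastiaans' window, biorthogonal to the integer time-frequency shifts of the Gaussian up
  to a constant. It is bounded but not square integrable: on the cell around \<open>k\<close> it decays only like \<open>exp (-2\<pi>\<bar>k\<bar>\<epsilon>)\<close> at distance
  \<open>\<epsilon>\<close> from the end of the cell that lies farther from \<open>0\<close>.\<close>

definition bastiaans :: "real \<Rightarrow> real"
  where "bastiaans x = exp (pi * x\<^sup>2) * tail_coeff (round x)"

definition gauss_atom :: "real \<Rightarrow> real \<Rightarrow> real \<Rightarrow> complex"
  where "gauss_atom s \<tau> x = exp (- pi * (x - s)\<^sup>2) *\<^sub>R cis (2 * pi * \<tau> * x)"

text \<open>Functions on the unit cell that vanish near its end points, where Bastiaans' window fails to be
  square integrable.\<close>

definition cell_profile :: "real \<Rightarrow> (real \<Rightarrow> complex) \<Rightarrow> bool"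
  where "cell_profile \<rho> \<phi> \<longleftrightarrow> \<phi> \<in> borel_measurable borel \<and> (\<forall>y. norm (\<phi> y) \<le> 1) \<and>
    (\<forall>y. \<rho> < \<bar>y\<bar> \<longrightarrow> \<phi> y = 0) \<and> \<rho> < 1/2"

text \<open>A translate of Bastiaans' window times the periodic extension of a profile. By biorthogonality,
  pairing a Gabor series with it isolates the coefficients over the single translation \<open>\<beta>\<close>, and the
  profile then tests the Fourier series that these coefficients form.\<close>

definition dual_test :: "int \<Rightarrow> (real \<Rightarrow> complex) \<Rightarrow> real \<Rightarrow> complex"
  where "dual_test \<beta> \<phi> x = bastiaans (x - of_int \<beta>) *\<^sub>R \<phi> (x - of_int (round x))"

lemma round_measurable [measurable]: "(round :: real \<Rightarrow> int) \<in> measurable borel (count_space UNIV)"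
  unfolding round_def by measurable

lemma bastiaans_measurable [measurable]: "bastiaans \<in> borel_measurable borel"
proof -
  have "(\<lambda>x::real. tail_coeff (round x)) \<in> borel_measurable borel"
    using measurable_comp[OF round_measurable, of tail_coeff borel] by (simp add: comp_def)
  then show ?thesis unfolding bastiaans_def by measurable
qed

lemma dual_test_measurable:
  assumes "cell_profile \<rho> \<phi>"
  shows "dual_test \<beta> \<phi> \<in> borel_measurable borel"
proof -
  have [measurable]: "\<phi> \<in> borel_measurable borel" using assms by (simp add: cell_profile_def)
  have [measurable]: "(\<lambda>x::real. real_of_int (round x)) \<in> borel_measurable borel"
    using measurable_comp[OF round_measurable, of real_of_int borel] by (simp add: comp_def)
  show ?thesis unfolding dual_test_def by measurable
qed

lemma gauss_atom_measurable [measurable]: "gauss_atom s \<tau> \<in> borel_measurable borel"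
  unfolding gauss_atom_def by (intro borel_measurable_continuous_onI continuous_intros)

lemma dual_test_shift:
  assumes "- 1/2 \<le> y" "y < 1/2"
  shows "dual_test \<beta> \<phi> (y + of_int k) = (exp (pi * (y + of_int (k - \<beta>))\<^sup>2) * tail_coeff (k - \<beta>)) *\<^sub>R \<phi> y"
proof -
  have "y + of_int k - of_int \<beta> = y + of_int (k - \<beta>)" by simp
  then show ?thesis
    using round_add_int[OF assms, of k] round_add_int[OF assms, of "k - \<beta>"]
    by (simp only: dual_test_def bastiaans_def) simp
qed

lemma summable_on_int_shift:
  fixes f :: "int \<Rightarrow> real"
  assumes "f summable_on UNIV"
  shows "(\<lambda>k. f (k - \<beta>)) summable_on UNIV"
  using assms
  by (subst summable_on_reindex_bij_betw[where g = "\<lambda>k. k - \<beta>" and B = UNIV])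
     (auto intro!: bij_betwI[where g = "\<lambda>k. k + \<beta>"])

text \<open>The gap between the support of the profile and the end points of the cell yields geometric decay
  from cell to cell.\<close>

lemma dual_test_square_integrable:
  assumes "cell_profile \<rho> \<phi>"
  shows "integrable lborel (\<lambda>x. (norm (dual_test \<beta> \<phi> x))\<^sup>2)"
proof (rule integrable_tiling)
  show "(\<lambda>x. (norm (dual_test \<beta> \<phi> x))\<^sup>2) \<in> borel_measurable borel"
    using dual_test_measurable[OF assms] by measurable
  have "\<rho> < 1/2" using assms by (simp add: cell_profile_def)
  show "(\<lambda>k. exp (- (4 * pi * (1/2 - \<rho>)) * \<bar>real_of_int (k - \<beta>)\<bar>)) summable_on UNIV"
    by (rule summable_on_int_shift, rule summable_on_exp_abs_int) (use \<open>\<rho> < 1/2\<close> in auto)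
  fix k :: int and y :: real
  assume y: "- 1/2 \<le> y" "y < 1/2"
  define m where "m = k - \<beta>"
  show "norm ((norm (dual_test \<beta> \<phi> (y + of_int k)))\<^sup>2) \<le> exp (- (4 * pi * (1/2 - \<rho>)) * \<bar>real_of_int (k - \<beta>)\<bar>)"
  proof (cases "\<phi> y = 0")
    case False
    then have yr: "\<bar>y\<bar> \<le> \<rho>" using assms by (force simp: cell_profile_def)
    have "norm (dual_test \<beta> \<phi> (y + of_int k)) = exp (pi * (y + of_int m)\<^sup>2) * \<bar>tail_coeff m\<bar> * norm (\<phi> y)"
      unfolding dual_test_shift[OF y] m_def by (simp add: abs_mult)
    also have "\<dots> \<le> exp (pi * (y + of_int m)\<^sup>2) * exp (- pi * (\<bar>real_of_int m\<bar> + 1/2)\<^sup>2) * 1"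
      using assms by (intro mult_mono abs_tail_coeff_le) (auto simp: cell_profile_def)
    also have "\<dots> = exp (pi * ((y + of_int m)\<^sup>2 - (\<bar>real_of_int m\<bar> + 1/2)\<^sup>2))"
      by (simp add: algebra_simps flip: exp_add)
    also have "\<dots> \<le> exp (- (2 * pi * (1/2 - \<rho>)) * \<bar>real_of_int m\<bar>)"
    proof -
      have "(y + of_int m)\<^sup>2 = \<bar>y + of_int m\<bar>\<^sup>2" by simp
      also have "\<dots> \<le> (\<bar>real_of_int m\<bar> + \<rho>)\<^sup>2"
        using yr by (intro power_mono) auto
      finally have "(y + of_int m)\<^sup>2 - (\<bar>real_of_int m\<bar> + 1/2)\<^sup>2 \<le> (\<bar>real_of_int m\<bar> + \<rho>)\<^sup>2 - (\<bar>real_of_int m\<bar> + 1/2)\<^sup>2"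
        by simp
      also have "\<dots> = - (2 * (1/2 - \<rho>) * \<bar>real_of_int m\<bar>) - (1/2 - \<rho>) * (\<rho> + 1/2)"
        by (simp add: power2_eq_square algebra_simps)
      also have "\<dots> \<le> - (2 * (1/2 - \<rho>) * \<bar>real_of_int m\<bar>)"
        using \<open>\<rho> < 1/2\<close> yr by (auto intro!: mult_nonneg_nonneg)
      finally have "pi * ((y + of_int m)\<^sup>2 - (\<bar>real_of_int m\<bar> + 1/2)\<^sup>2) \<le> pi * - (2 * (1/2 - \<rho>) * \<bar>real_of_int m\<bar>)"
        by (intro mult_left_mono) auto
      then show ?thesis by (simp add: algebra_simps)
    qed
    finally have "(norm (dual_test \<beta> \<phi> (y + of_int k)))\<^sup>2 \<le> (exp (- (2 * pi * (1/2 - \<rho>)) * \<bar>real_of_int m\<bar>))\<^sup>2"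
      by (intro power_mono) auto
    also have "\<dots> = exp (- (4 * pi * (1/2 - \<rho>)) * \<bar>real_of_int m\<bar>)"
      by (simp add: power2_eq_square flip: exp_add)
    finally show ?thesis by (simp add: m_def)
  qed (simp add: dual_test_shift[OF y])
qed

text \<open>The quadratic exponents of the Gaussian and of the dual window cancel, so the product splits into a
  constant, a factor depending only on the cell, and a factor depending only on the position in the
  cell. For this reason the sum over the cells and the integral over one cell never interact.\<close>

lemma gauss_atom_dual_test_shift:
  assumes "- 1/2 \<le> y" "y < 1/2"
  shows "gauss_atom s \<tau> (y + of_int k) * dual_test \<beta> \<phi> (y + of_int k) =
    (exp (- pi * (s - \<beta>)\<^sup>2) *\<^sub>R cis (2 * pi * \<tau> * \<beta>)) *
    ((exp (2 * pi * (s - \<beta>) * of_int (k - \<beta>)) * tail_coeff (k - \<beta>)) *\<^sub>R cis (2 * pi * \<tau> * of_int (k - \<beta>))) *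
    (exp (2 * pi * (s - \<beta>) * y) *\<^sub>R cis (2 * pi * \<tau> * y) * \<phi> y)"
proof -
  have e: "- pi * (y + of_int k - s)\<^sup>2 + pi * (y + of_int (k - \<beta>))\<^sup>2
      = - pi * (s - \<beta>)\<^sup>2 + 2 * pi * (s - \<beta>) * of_int (k - \<beta>) + 2 * pi * (s - \<beta>) * y"
    by (simp add: power2_eq_square algebra_simps)
  have c: "2 * pi * \<tau> * (y + of_int k) = 2 * pi * \<tau> * \<beta> + 2 * pi * \<tau> * of_int (k - \<beta>) + 2 * pi * \<tau> * y"
    by (simp add: algebra_simps)
  have "gauss_atom s \<tau> (y + of_int k) * dual_test \<beta> \<phi> (y + of_int k) =
     (exp (- pi * (y + of_int k - s)\<^sup>2 + pi * (y + of_int (k - \<beta>))\<^sup>2) * tail_coeff (k - \<beta>)) *\<^sub>R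
       (cis (2 * pi * \<tau> * (y + of_int k)) * \<phi> y)"
    unfolding gauss_atom_def dual_test_shift[OF assms] exp_add by simp
  then show ?thesis
    unfolding e c exp_add cis_mult[symmetric] by (simp add: scaleR_conv_of_real)
qed

lemma gauss_atom_dual_test_integral:
  assumes \<phi>: "cell_profile \<rho> \<phi>"
  shows integrable_gauss_atom_dual_test: "integrable lborel (\<lambda>x. gauss_atom s \<tau> x * dual_test \<beta> \<phi> x)"
    and integral_gauss_atom_dual_test:
      "((\<lambda>m. (exp (2 * pi * (s - \<beta>) * of_int m) * tail_coeff m) *\<^sub>R cis (2 * pi * \<tau> * of_int m)) has_sum Z) UNIV \<Longrightarrow>
       (\<integral>x. gauss_atom s \<tau> x * dual_test \<beta> \<phi> x \<partial>lborel) =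
       (exp (- pi * (s - \<beta>)\<^sup>2) *\<^sub>R cis (2 * pi * \<tau> * \<beta>)) * Z *
       (\<integral>y. exp (2 * pi * (s - \<beta>) * y) *\<^sub>R cis (2 * pi * \<tau> * y) * \<phi> y \<partial>lborel)"
proof -
  let ?c = "exp (- pi * (s - \<beta>)\<^sup>2) *\<^sub>R cis (2 * pi * \<tau> * \<beta>)"
  let ?z = "\<lambda>m. (exp (2 * pi * (s - \<beta>) * of_int m) * tail_coeff m) *\<^sub>R cis (2 * pi * \<tau> * of_int m)"
  let ?F = "\<lambda>y. exp (2 * pi * (s - \<beta>) * y) *\<^sub>R cis (2 * pi * \<tau> * y) * \<phi> y"
  have [measurable]: "dual_test \<beta> \<phi> \<in> borel_measurable borel"
    by (rule dual_test_measurable[OF \<phi>])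
  have meas: "(\<lambda>x. gauss_atom s \<tau> x * dual_test \<beta> \<phi> x) \<in> borel_measurable borel" by measurable
  let ?M = "\<lambda>k. exp (- pi * (s - \<beta>)\<^sup>2) * exp (pi * \<bar>s - \<beta>\<bar>) *
      (exp (2 * pi * (s - \<beta>) * of_int (k - \<beta>)) * \<bar>tail_coeff (k - \<beta>)\<bar>)"
  have M: "?M summable_on UNIV"
    by (intro summable_on_cmult_right summable_on_int_shift[of "\<lambda>k. exp (2 * pi * (s - \<beta>) * of_int k) * \<bar>tail_coeff k\<bar>"]
          abs_summable_exp_tail_coeff)
  have bound: "norm (gauss_atom s \<tau> (y + of_int k) * dual_test \<beta> \<phi> (y + of_int k)) \<le> ?M k"
    if y: "- 1/2 \<le> y" "y < 1/2" for y and k :: int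
  proof -
    have "(s - \<beta>) * y \<le> \<bar>s - \<beta>\<bar> * \<bar>y\<bar>"
      by (metis abs_ge_self abs_mult)
    also have "\<dots> \<le> \<bar>s - \<beta>\<bar> * (1/2)"
      using y by (intro mult_left_mono) auto
    finally have "(s - \<beta>) * y \<le> \<bar>s - \<beta>\<bar> * (1/2)" .
    then have "2 * pi * ((s - \<beta>) * y) \<le> 2 * pi * (\<bar>s - \<beta>\<bar> * (1/2))"
      by (intro mult_left_mono) auto
    then have "exp (2 * pi * (s - \<beta>) * y) \<le> exp (pi * \<bar>s - \<beta>\<bar>)"
      by (simp add: mult.assoc)
    moreover have "norm (\<phi> y) \<le> 1" using \<phi> by (simp add: cell_profile_def)
    ultimately have "norm (?F y) \<le> exp (pi * \<bar>s - \<beta>\<bar>) * 1"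
      unfolding norm_mult norm_scaleR norm_cis by (intro mult_mono) auto
    then have "norm (?c * ?z (k - \<beta>)) * norm (?F y) \<le> norm (?c * ?z (k - \<beta>)) * (exp (pi * \<bar>s - \<beta>\<bar>) * 1)"
      by (intro mult_left_mono) auto
    then show ?thesis
      unfolding gauss_atom_dual_test_shift[OF y] norm_mult[of _ "?F y"]
      by (simp add: norm_mult abs_mult mult_ac)
  qed
  show "integrable lborel (\<lambda>x. gauss_atom s \<tau> x * dual_test \<beta> \<phi> x)"
    by (rule integrable_tiling[OF meas M bound])
  assume Z: "(?z has_sum Z) UNIV"
  have z0: "\<phi> y = 0" if "y \<notin> {-1/2..<1/2}" for y
    using \<phi> that by (auto simp: cell_profile_def)
  have piece: "(\<integral>y. indicator {-1/2..<1/2} y *\<^sub>R (gauss_atom s \<tau> (y + of_int k) * dual_test \<beta> \<phi> (y + of_int k)) \<partial>lborel)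
      = ?c * ?z (k - \<beta>) * (\<integral>y. ?F y \<partial>lborel)" for k
  proof -
    have "(\<integral>y. indicator {-1/2..<1/2} y *\<^sub>R (gauss_atom s \<tau> (y + of_int k) * dual_test \<beta> \<phi> (y + of_int k)) \<partial>lborel)
      = (\<integral>y. ?c * ?z (k - \<beta>) * ?F y \<partial>lborel)"
    proof (rule Bochner_Integration.integral_cong[OF refl])
      fix y
      show "indicator {-1/2..<1/2} y *\<^sub>R (gauss_atom s \<tau> (y + of_int k) * dual_test \<beta> \<phi> (y + of_int k)) = ?c * ?z (k - \<beta>) * ?F y"
      proof (cases "y \<in> {-1/2..<1/2}")
        case True
        then show ?thesis using gauss_atom_dual_test_shift[of y s \<tau> k \<beta> \<phi>] by simp
      qed (simp add: z0)
    qed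
    then show ?thesis by (simp only: integral_mult_right_zero)
  qed
  have "((\<lambda>k. ?z (k - \<beta>)) has_sum Z) UNIV"
    by (rule iffD2[OF has_sum_reindex_bij_betw[where f = ?z] Z])
       (auto intro!: bij_betwI[where g = "\<lambda>k. k + \<beta>"])
  then have "((\<lambda>k. ?c * ?z (k - \<beta>) * (\<integral>y. ?F y \<partial>lborel)) has_sum (?c * Z * (\<integral>y. ?F y \<partial>lborel))) UNIV"
    by (intro has_sum_cmult_left has_sum_cmult_right)
  with has_sum_tiling[OF meas M bound, unfolded piece]
  show "(\<integral>x. gauss_atom s \<tau> x * dual_test \<beta> \<phi> x \<partial>lborel) = ?c * Z * (\<integral>y. ?F y \<partial>lborel)"
    by (rule has_sum_unique)
qed

section \<open>Bessel's inequality on the unit cell\<close>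

lemma integrable_on_cell:
  fixes f :: "real \<Rightarrow> complex"
  assumes "f \<in> borel_measurable borel" "\<And>y. norm (f y) \<le> indicator {-1/2..1/2} y * B"
  shows "integrable lborel f"
  by (rule Bochner_Integration.integrable_bound[where f = "\<lambda>y. indicator {-1/2..1/2::real} y * B"])
     (use assms in \<open>auto intro: order_trans[OF _ abs_ge_self]\<close>)

lemma integral_character_cell:
  fixes k :: int
  shows "(\<integral>y. indicator {-1/2..1/2} y *\<^sub>R cis (2 * pi * of_int k * y) \<partial>lborel) = (if k = 0 then 1 else 0)"
proof (cases "k = 0")
  case False
  define c where "c = 2 * pi * of_int k"
  have c: "c \<noteq> 0" using False by (simp add: c_def)
  let ?F = "\<lambda>y. cis (c * y) / (\<i> * of_real c)"
  have "(?F has_vector_derivative cis (c * y)) (at y within A)" for y A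
  proof -
    have "((\<lambda>y. cis (c * y)) has_vector_derivative (c *\<^sub>R (\<i> * cis (c * y)))) (at y within A)"
      by (auto intro!: derivative_eq_intros simp: has_vector_derivative_def scaleR_conv_of_real)
    from has_vector_derivative_divide[OF this, of "\<i> * of_real c"] show ?thesis
      using c by (simp add: scaleR_conv_of_real field_simps)
  qed
  then have "(\<integral>y. indicator {-1/2..1/2} y *\<^sub>R cis (c * y) \<partial>lborel) = ?F (1/2) - ?F (-1/2)"
    by (intro integral_FTC_Icc) (auto intro!: continuous_intros)
  also have "cis (c * (1/2)) = cis (c * (-1/2))"
  proof -
    have "cis (c * (1/2)) = cis (c * (-1/2)) * cis c"
      by (simp add: cis_mult)
    also have "cis c = 1" by (simp add: c_def)
    finally show ?thesis by simp
  qed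
  finally show ?thesis using False by (simp add: c_def)
qed (simp add: scaleR_conv_of_real)

definition cell_fourier :: "(real \<Rightarrow> complex) \<Rightarrow> real \<Rightarrow> complex"
  where "cell_fourier \<phi> \<omega> = (\<integral>y. cis (2 * pi * \<omega> * y) * \<phi> y \<partial>lborel)"

text \<open>Expansion of the squared distance from \<open>\<phi>\<close> to its partial Fourier sum, restricted to the cell.\<close>

lemma Bessel_cell_fourier:
  assumes \<phi>: "cell_profile \<rho> \<phi>" and F: "finite F"
  shows "(\<Sum>n\<in>F. (norm (cell_fourier \<phi> (of_int n)))\<^sup>2) \<le> (\<integral>y. (norm (\<phi> y))\<^sup>2 \<partial>lborel)"
proof -
  have [measurable]: "\<phi> \<in> borel_measurable borel" using \<phi> by (simp add: cell_profile_def)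
  have le1: "norm (\<phi> y) \<le> 1" for y using \<phi> by (simp add: cell_profile_def)
  let ?I = "\<lambda>y. indicator {-1/2..1/2::real} y :: real"
  have supp: "?I y *\<^sub>R \<phi> y = \<phi> y" for y
    using \<phi> by (auto simp: cell_profile_def indicator_def)
  have supp_le: "norm (\<phi> y) \<le> ?I y" for y
    using \<phi> by (auto simp: cell_profile_def indicator_def)
  define c where "c n = cell_fourier \<phi> (of_int n)" for n :: int
  define e where "e n y = cis (2 * pi * of_int n * y)" for n :: int and y
  have [measurable]: "e n \<in> borel_measurable borel" for n
    unfolding e_def by (intro borel_measurable_continuous_onI continuous_intros)
  define P where "P y = (\<Sum>n\<in>F. c n * cnj (e n y))" for y
  have [measurable]: "(\<lambda>y. cnj (f y)) \<in> borel_measurable borel" 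
    if "f \<in> borel_measurable borel" for f :: "real \<Rightarrow> complex"
    by (rule measurable_compose[OF that, of cnj])
       (intro borel_measurable_continuous_onI continuous_intros)
  have [measurable]: "P \<in> borel_measurable borel" unfolding P_def by measurable
  have ene: "norm (e n y) = 1" for n y by (simp add: e_def)
  have i1: "integrable lborel (\<lambda>y. \<phi> y * cnj (\<phi> y))"
    by (rule integrable_on_cell[where B = 1])
       (use le1 supp_le in \<open>auto simp: norm_mult intro: order_trans[OF mult_left_le]\<close>)
  have i2: "integrable lborel (\<lambda>y. e n y * \<phi> y)" for n
    by (rule integrable_on_cell[where B = 1]) (use supp_le in \<open>auto simp: norm_mult ene\<close>)
  have i4: "integrable lborel (\<lambda>y. ?I y *\<^sub>R (e m y * cnj (e n y)))" for m n
    by (rule integrable_on_cell[where B = 1]) (auto simp: norm_mult ene)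
  have c: "(\<integral>y. e n y * \<phi> y \<partial>lborel) = c n" for n
    by (simp add: c_def e_def cell_fourier_def)
  have c': "(\<integral>y. cnj (e n y * \<phi> y) \<partial>lborel) = cnj (c n)" for n
    unfolding c[symmetric] by (rule Bochner_Integration.integral_cnj)
  have orth: "(\<integral>y. ?I y *\<^sub>R (e m y * cnj (e n y)) \<partial>lborel) = (if m = n then 1 else 0)" for m n
  proof -
    have "e m y * cnj (e n y) = cis (2 * pi * of_int (m - n) * y)" for y
      by (simp add: e_def cis_cnj cis_mult algebra_simps)
    then show ?thesis using integral_character_cell[of "m - n"] by simp
  qed
  have expand: "complex_of_real ((norm (\<phi> y - ?I y *\<^sub>R P y))\<^sup>2) = \<phi> y * cnj (\<phi> y)
      - (\<Sum>n\<in>F. cnj (c n) * (e n y * \<phi> y)) - (\<Sum>n\<in>F. c n * cnj (e n y * \<phi> y))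
      + (\<Sum>n\<in>F. \<Sum>m\<in>F. (c n * cnj (c m)) * (?I y *\<^sub>R (e m y * cnj (e n y))))" for y
  proof -
    have "complex_of_real ((norm (\<phi> y - ?I y *\<^sub>R P y))\<^sup>2)
        = \<phi> y * cnj (\<phi> y) - (?I y *\<^sub>R \<phi> y) * cnj (P y) - P y * cnj (?I y *\<^sub>R \<phi> y) + (?I y * ?I y) *\<^sub>R (P y * cnj (P y))"
      unfolding complex_norm_square by (simp add: scaleR_conv_of_real algebra_simps)
    also have "?I y * ?I y = ?I y" by (simp add: indicator_def)
    also have "\<phi> y * cnj (\<phi> y) - (?I y *\<^sub>R \<phi> y) * cnj (P y) - P y * cnj (?I y *\<^sub>R \<phi> y) + ?I y *\<^sub>R (P y * cnj (P y))
        = \<phi> y * cnj (\<phi> y) - \<phi> y * cnj (P y) - P y * cnj (\<phi> y) + ?I y *\<^sub>R (P y * cnj (P y))"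
      by (simp only: supp)
    also have "\<phi> y * cnj (P y) = (\<Sum>n\<in>F. cnj (c n) * (e n y * \<phi> y))"
      by (simp add: P_def sum_distrib_left mult_ac)
    also have "P y * cnj (\<phi> y) = (\<Sum>n\<in>F. c n * cnj (e n y * \<phi> y))"
      by (simp add: P_def sum_distrib_left mult_ac)
    also have "P y * cnj (P y) = (\<Sum>n\<in>F. \<Sum>m\<in>F. (c n * cnj (c m)) * (e m y * cnj (e n y)))"
      by (simp add: P_def sum_product mult_ac)
    also have "?I y *\<^sub>R \<dots> = (\<Sum>n\<in>F. \<Sum>m\<in>F. (c n * cnj (c m)) * (?I y *\<^sub>R (e m y * cnj (e n y))))"
      by (simp only: scaleR_sum_right mult_scaleR_right)
    finally show ?thesis .
  qed
  have "complex_of_real (\<integral>y. (norm (\<phi> y - ?I y *\<^sub>R P y))\<^sup>2 \<partial>lborel)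
      = (\<integral>y. complex_of_real ((norm (\<phi> y - ?I y *\<^sub>R P y))\<^sup>2) \<partial>lborel)"
    by (rule integral_complex_of_real[symmetric])
  also have "\<dots> = (\<integral>y. \<phi> y * cnj (\<phi> y) \<partial>lborel)
      - (\<Sum>n\<in>F. cnj (c n) * c n) - (\<Sum>n\<in>F. c n * cnj (c n))
      + (\<Sum>n\<in>F. \<Sum>m\<in>F. (c n * cnj (c m)) * (if m = n then 1 else 0))"
    unfolding expand
    by (subst Bochner_Integration.integral_add Bochner_Integration.integral_diff Bochner_Integration.integral_sum
          integral_mult_right_zero c c' orth
        | (intro Bochner_Integration.integrable_add Bochner_Integration.integrable_diff Bochner_Integration.integrable_sum
          integrable_mult_right i1 i2 i4 integrable_cnj; fail))+ simp
  also have "\<dots> = (\<integral>y. \<phi> y * cnj (\<phi> y) \<partial>lborel) - (\<Sum>n\<in>F. c n * cnj (c n))"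
    using F by (simp add: if_distrib sum.delta mult.commute cong: if_cong)
  also have "\<dots> = complex_of_real ((\<integral>y. (norm (\<phi> y))\<^sup>2 \<partial>lborel) - (\<Sum>n\<in>F. (norm (c n))\<^sup>2))"
    unfolding complex_norm_square[symmetric] by (simp only: integral_complex_of_real of_real_diff of_real_sum)
  finally have "(\<integral>y. (norm (\<phi> y - ?I y *\<^sub>R P y))\<^sup>2 \<partial>lborel) = (\<integral>y. (norm (\<phi> y))\<^sup>2 \<partial>lborel) - (\<Sum>n\<in>F. (norm (c n))\<^sup>2)"
    by (simp only: of_real_eq_iff)
  moreover have "0 \<le> (\<integral>y. (norm (\<phi> y - ?I y *\<^sub>R P y))\<^sup>2 \<partial>lborel)" by simp
  ultimately show ?thesis by (simp add: c_def)
qed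

section \<open>Tensor products, the Cauchy--Schwarz inequality and pairings in \<open>L\<^sup>2\<close>\<close>

lemma Basis_real2: "(Basis :: (real^2) set) = {axis 1 1, axis 2 1}"
  by (auto simp: Basis_vec_def UNIV_2)

text \<open>Lebesgue measure on the plane is the image of a product measure over the two basis vectors.\<close>

lemma tensor_integral:
  fixes f1 f2 :: "real \<Rightarrow> 'a::{real_normed_field, banach, second_countable_topology}"
  assumes "integrable lborel f1" "integrable lborel f2"
  shows integrable_tensor: "integrable lborel (\<lambda>x::real^2. f1 (x $ 1) * f2 (x $ 2))"
    and integral_tensor:
      "(\<integral>x. f1 ((x::real^2) $ 1) * f2 (x $ 2) \<partial>lborel) = (\<integral>x. f1 x \<partial>lborel) * (\<integral>x. f2 x \<partial>lborel)"
proof -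
  interpret product_sigma_finite "\<lambda>_::real^2. lborel :: real measure"
    by standard
  let ?g = "\<lambda>f :: real^2 \<Rightarrow> real. \<Sum>b\<in>Basis. f b *\<^sub>R b"
  let ?P = "Pi\<^sub>M (Basis :: (real^2) set) (\<lambda>_. lborel :: real measure)"
  have ne: "axis 1 1 \<noteq> (axis 2 1 :: real^2)" by (simp add: axis_eq_axis)
  have L: "(lborel :: (real^2) measure) = distr ?P borel ?g" by (rule lborel_eq)
  have [measurable]: "?g \<in> measurable ?P borel" by measurable
  have [measurable]: "f1 \<in> borel_measurable borel" "f2 \<in> borel_measurable borel"
    using assms by (auto dest: borel_measurable_integrable)
  have [measurable]: "(\<lambda>x::real^2. f1 (x $ 1) * f2 (x $ 2)) \<in> borel_measurable borel" by measurable
  define k :: "real^2 \<Rightarrow> real \<Rightarrow> 'a" where "k b = (if b = axis 1 1 then f1 else f2)" for b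
  have ki: "integrable lborel (k b)" for b using assms by (simp add: k_def)
  have eq: "f1 (?g f $ 1) * f2 (?g f $ 2) = (\<Prod>b\<in>Basis. k b (f b))" for f
    using ne by (simp add: Basis_real2 k_def axis_def)
  show "integrable lborel (\<lambda>x::real^2. f1 (x $ 1) * f2 (x $ 2))"
    unfolding L by (subst integrable_distr_eq) (auto simp only: eq intro!: product_integrable_prod ki, measurable)
  have "(\<integral>x. f1 ((x::real^2) $ 1) * f2 (x $ 2) \<partial>lborel) = (\<integral>f. (\<Prod>b\<in>Basis. k b (f b)) \<partial>?P)"
    unfolding L by (subst integral_distr) (simp_all only: eq, measurable)
  also have "\<dots> = (\<Prod>b\<in>Basis. integral\<^sup>L lborel (k b))"
    by (rule product_integral_prod) (auto intro: ki)
  also have "\<dots> = (\<integral>x. f1 x \<partial>lborel) * (\<integral>x. f2 x \<partial>lborel)"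
    using ne by (simp add: Basis_real2 k_def)
  finally show "(\<integral>x. f1 ((x::real^2) $ 1) * f2 (x $ 2) \<partial>lborel) = (\<integral>x. f1 x \<partial>lborel) * (\<integral>x. f2 x \<partial>lborel)" .
qed

text \<open>The hypotheses concern finite partial sums only, so that they can be fed directly by Bessel's
  inequality.\<close>

lemma has_sum_Cauchy_Schwarz:
  fixes a w :: "'i \<Rightarrow> complex"
  assumes s: "((\<lambda>i. a i * w i) has_sum s) A"
    and N: "\<And>F. finite F \<Longrightarrow> F \<subseteq> A \<Longrightarrow> (\<Sum>i\<in>F. (norm (a i))\<^sup>2) \<le> N"
    and W: "\<And>F. finite F \<Longrightarrow> F \<subseteq> A \<Longrightarrow> (\<Sum>i\<in>F. (norm (w i))\<^sup>2) \<le> W"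
  shows "(norm s)\<^sup>2 \<le> N * W"
proof -
  have N0: "0 \<le> N" using N[of "{}"] by simp
  have "((\<lambda>F. (norm (\<Sum>i\<in>F. a i * w i))\<^sup>2) \<longlongrightarrow> (norm s)\<^sup>2) (finite_subsets_at_top A)"
    using s unfolding has_sum_def by (intro tendsto_intros)
  moreover have "\<forall>\<^sub>F F in finite_subsets_at_top A. (norm (\<Sum>i\<in>F. a i * w i))\<^sup>2 \<le> N * W"
  proof (rule eventually_finite_subsets_at_top_weakI)
    fix F assume F: "finite F" "F \<subseteq> A"
    have "norm (\<Sum>i\<in>F. a i * w i) \<le> (\<Sum>i\<in>F. norm (a i) * norm (w i))"
      by (rule order_trans[OF norm_sum]) (simp add: norm_mult)
    then have "(norm (\<Sum>i\<in>F. a i * w i))\<^sup>2 \<le> (\<Sum>i\<in>F. norm (a i) * norm (w i))\<^sup>2"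
      by (intro power_mono) auto
    also have "\<dots> \<le> (\<Sum>i\<in>F. (norm (a i))\<^sup>2) * (\<Sum>i\<in>F. (norm (w i))\<^sup>2)"
      by (rule Cauchy_Schwarz_ineq_sum)
    also have "\<dots> \<le> N * W"
      using F by (intro mult_mono N W N0 sum_nonneg) auto
    finally show "(norm (\<Sum>i\<in>F. a i * w i))\<^sup>2 \<le> N * W" .
  qed
  ultimately show ?thesis
    by (rule tendsto_upperbound) simp
qed

lemma sum_product_le:
  fixes f :: "'i \<Rightarrow> real" and g :: "'j \<Rightarrow> real"
  assumes "\<And>i. 0 \<le> f i" "\<And>j. 0 \<le> g j"
    and f: "\<And>F. finite F \<Longrightarrow> sum f F \<le> X" and g: "\<And>F. finite F \<Longrightarrow> sum g F \<le> Y" and F: "finite F"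
  shows "(\<Sum>(i, j)\<in>F. f i * g j) \<le> X * Y"
proof -
  have "(\<Sum>(i, j)\<in>F. f i * g j) \<le> (\<Sum>(i, j)\<in>fst ` F \<times> snd ` F. f i * g j)"
    using assms by (intro sum_mono2) (force intro: mult_nonneg_nonneg)+
  also have "\<dots> = sum f (fst ` F) * sum g (snd ` F)"
    by (simp add: sum_product sum.cartesian_product)
  also have "\<dots> \<le> X * Y"
    using f[of "{}"] assms by (intro mult_mono f g sum_nonneg) auto
  finally show ?thesis .
qed

lemma Cauchy_Schwarz_integral:
  fixes u v :: "'a \<Rightarrow> real"
  assumes [measurable]: "u \<in> borel_measurable M" "v \<in> borel_measurable M"
    and nn: "\<And>x. 0 \<le> u x" "\<And>x. 0 \<le> v x"
    and iu: "integrable M (\<lambda>x. (u x)\<^sup>2)" and iv: "integrable M (\<lambda>x. (v x)\<^sup>2)"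
  shows "integrable M (\<lambda>x. u x * v x)"
    and "(\<integral>x. u x * v x \<partial>M) \<le> sqrt (\<integral>x. (u x)\<^sup>2 \<partial>M) * sqrt (\<integral>x. (v x)\<^sup>2 \<partial>M)"
proof -
  show i: "integrable M (\<lambda>x. u x * v x)"
  proof (rule Bochner_Integration.integrable_bound[OF Bochner_Integration.integrable_add[OF iu iv]])
    show "AE x in M. norm (u x * v x) \<le> norm ((u x)\<^sup>2 + (v x)\<^sup>2)"
    proof (rule AE_I2)
      fix x
      have "2 * u x * v x \<le> (u x)\<^sup>2 + (v x)\<^sup>2" by (rule sum_squares_bound)
      moreover have "0 \<le> u x * v x" using nn by simp
      ultimately show "norm (u x * v x) \<le> norm ((u x)\<^sup>2 + (v x)\<^sup>2)" by simp
    qed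
  qed measurable
  have "(\<integral>\<^sup>+x. ennreal (u x) * ennreal (v x) \<partial>M)\<^sup>2 \<le> (\<integral>\<^sup>+x. ennreal (u x) ^ 2 \<partial>M) * (\<integral>\<^sup>+x. ennreal (v x) ^ 2 \<partial>M)"
    by (rule Cauchy_Schwarz_nn_integral) auto
  also have "(\<integral>\<^sup>+x. ennreal (u x) * ennreal (v x) \<partial>M) = ennreal (\<integral>x. u x * v x \<partial>M)"
    using nn i by (subst nn_integral_eq_integral[symmetric]) (auto simp: ennreal_mult)
  also have "(\<integral>\<^sup>+x. ennreal (u x) ^ 2 \<partial>M) = ennreal (\<integral>x. (u x)\<^sup>2 \<partial>M)"
    using nn iu by (subst nn_integral_eq_integral[symmetric]) (auto simp: ennreal_power)
  also have "(\<integral>\<^sup>+x. ennreal (v x) ^ 2 \<partial>M) = ennreal (\<integral>x. (v x)\<^sup>2 \<partial>M)"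
    using nn iv by (subst nn_integral_eq_integral[symmetric]) (auto simp: ennreal_power)
  finally have "(\<integral>x. u x * v x \<partial>M)\<^sup>2 \<le> (\<integral>x. (u x)\<^sup>2 \<partial>M) * (\<integral>x. (v x)\<^sup>2 \<partial>M)"
    using nn by (simp add: ennreal_power ennreal_mult[symmetric])
  then show "(\<integral>x. u x * v x \<partial>M) \<le> sqrt (\<integral>x. (u x)\<^sup>2 \<partial>M) * sqrt (\<integral>x. (v x)\<^sup>2 \<partial>M)"
    unfolding real_sqrt_mult[symmetric] by (rule real_le_rsqrt)
qed

lemma L2_add: "(\<lambda>x. f x + g x) \<in> L2" if "f \<in> L2" "g \<in> L2" for f g
proof -
  have [measurable]: "f \<in> borel_measurable lebesgue" "g \<in> borel_measurable lebesgue"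
    and i: "integrable lebesgue (\<lambda>x. (norm (f x))\<^sup>2)" "integrable lebesgue (\<lambda>x. (norm (g x))\<^sup>2)"
    using that by (auto simp: L2_def)
  have m: "(\<lambda>x. f x + g x) \<in> borel_measurable lebesgue" by measurable
  have "integrable lebesgue (\<lambda>x. 2 * (norm (f x))\<^sup>2 + 2 * (norm (g x))\<^sup>2)"
    using i by (intro Bochner_Integration.integrable_add integrable_mult_right)
  then have "integrable lebesgue (\<lambda>x. (norm (f x + g x))\<^sup>2)"
  proof (rule Bochner_Integration.integrable_bound)
    show "(\<lambda>x. (norm (f x + g x))\<^sup>2) \<in> borel_measurable lebesgue" using m by measurable
    show "AE x in lebesgue. norm ((norm (f x + g x))\<^sup>2) \<le> norm (2 * (norm (f x))\<^sup>2 + 2 * (norm (g x))\<^sup>2)"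
    proof (rule AE_I2)
      fix x
      have "(norm (f x + g x))\<^sup>2 \<le> (norm (f x) + norm (g x))\<^sup>2"
        by (intro power_mono) (auto intro: norm_triangle_ineq)
      also have "\<dots> \<le> 2 * (norm (f x))\<^sup>2 + 2 * (norm (g x))\<^sup>2"
        using sum_squares_bound[of "norm (f x)" "norm (g x)"] by (simp add: power2_sum)
      finally show "norm ((norm (f x + g x))\<^sup>2) \<le> norm (2 * (norm (f x))\<^sup>2 + 2 * (norm (g x))\<^sup>2)" by simp
    qed
  qed
  with m show ?thesis by (simp add: L2_def)
qed

lemma L2_uminus: "(\<lambda>x. - f x) \<in> L2" if "f \<in> L2"
  using that by (auto simp: L2_def)

lemma L2_sum: "(\<lambda>x. \<Sum>a\<in>F. g a x) \<in> L2" if "\<And>a. a \<in> F \<Longrightarrow> g a \<in> L2"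
  using that
proof (induction F rule: infinite_finite_induct)
  case (insert a F)
  then have "(\<lambda>x. g a x + (\<Sum>a\<in>F. g a x)) \<in> L2" by (intro L2_add) auto
  then show ?case using insert by simp
qed (auto simp: L2_def)

lemma L2_pairing:
  fixes T :: "quat \<Rightarrow> complex" and h :: "real^2 \<Rightarrow> complex"
  assumes T: "bounded_linear T" and B: "\<And>q. norm (T q) \<le> B * norm q"
    and h[measurable]: "h \<in> borel_measurable lebesgue" and h2: "integrable lebesgue (\<lambda>x. (norm (h x))\<^sup>2)"
    and f: "f \<in> L2"
  shows "integrable lebesgue (\<lambda>x. T (f x) * h x)"
    and "norm (\<integral>x. T (f x) * h x \<partial>lebesgue) \<le> B * (L2_norm f * sqrt (\<integral>x. (norm (h x))\<^sup>2 \<partial>lebesgue))"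
proof -
  have [measurable]: "f \<in> borel_measurable lebesgue"
    and f2: "integrable lebesgue (\<lambda>x. (norm (f x))\<^sup>2)"
    using f by (auto simp: L2_def)
  have [measurable]: "(\<lambda>x. T (f x)) \<in> borel_measurable lebesgue"
    using T by (intro borel_measurable_continuous_on[of T]) (auto intro: linear_continuous_on)
  note CS = Cauchy_Schwarz_integral[of "\<lambda>x. norm (f x)" lebesgue "\<lambda>x. norm (h x)", OF _ _ norm_ge_zero norm_ge_zero f2 h2]
  have i: "integrable lebesgue (\<lambda>x. B * (norm (f x) * norm (h x)))"
    by (intro integrable_mult_right CS(1)) measurable
  have le: "norm (T (f x) * h x) \<le> B * (norm (f x) * norm (h x))" for x
    using mult_right_mono[OF B[of "f x"], of "norm (h x)"] by (simp add: norm_mult mult.assoc)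
  show i': "integrable lebesgue (\<lambda>x. T (f x) * h x)"
    by (rule Bochner_Integration.integrable_bound[OF i])
       (use le in \<open>auto intro: order_trans[OF _ abs_ge_self]\<close>)
  have B0: "0 \<le> B" using order_trans[OF norm_ge_zero B[of 1]] by simp
  have "norm (\<integral>x. T (f x) * h x \<partial>lebesgue) \<le> (\<integral>x. norm (T (f x) * h x) \<partial>lebesgue)"
    by (rule integral_norm_bound)
  also have "\<dots> \<le> (\<integral>x. B * (norm (f x) * norm (h x)) \<partial>lebesgue)"
    by (intro integral_mono integrable_norm i' i le)
  also have "\<dots> = B * (\<integral>x. norm (f x) * norm (h x) \<partial>lebesgue)" by simp
  also have "\<dots> \<le> B * (L2_norm f * sqrt (\<integral>x. (norm (h x))\<^sup>2 \<partial>lebesgue))"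
    unfolding L2_norm_def by (intro mult_left_mono CS(2) B0) measurable
  finally show "norm (\<integral>x. T (f x) * h x \<partial>lebesgue) \<le> B * (L2_norm f * sqrt (\<integral>x. (norm (h x))\<^sup>2 \<partial>lebesgue))" .
qed

text \<open>Pairing with a square integrable function is continuous on \<open>L\<^sup>2\<close>; this is how the convergence of
  the series enters.\<close>

lemma L2_has_sum_pairing:
  fixes T :: "quat \<Rightarrow> complex" and h :: "real^2 \<Rightarrow> complex"
  assumes T: "bounded_linear T" and B: "\<And>q. norm (T q) \<le> B * norm q"
    and h: "h \<in> borel_measurable lebesgue" and h2: "integrable lebesgue (\<lambda>x. (norm (h x))\<^sup>2)"
    and S: "L2_has_sum g S A"
  shows "((\<lambda>a. \<integral>x. T (g a x) * h x \<partial>lebesgue) has_sum (\<integral>x. T (S x) * h x \<partial>lebesgue)) A"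
proof -
  interpret T: bounded_linear T by fact
  have SL: "S \<in> L2" and gL: "\<And>a. a \<in> A \<Longrightarrow> g a \<in> L2"
    and lim: "((\<lambda>F. L2_norm (\<lambda>x. (\<Sum>a\<in>F. g a x) - S x)) \<longlongrightarrow> 0) (finite_subsets_at_top A)"
    using S by (auto simp: L2_has_sum_def)
  note P = L2_pairing[OF T B h h2]
  let ?H = "sqrt (\<integral>x. (norm (h x))\<^sup>2 \<partial>lebesgue)"
  have "((\<lambda>F. (\<Sum>a\<in>F. \<integral>x. T (g a x) * h x \<partial>lebesgue) - (\<integral>x. T (S x) * h x \<partial>lebesgue)) \<longlongrightarrow> 0)
      (finite_subsets_at_top A)"
  proof (rule Lim_null_comparison)
    show "((\<lambda>F. B * (L2_norm (\<lambda>x. (\<Sum>a\<in>F. g a x) - S x) * ?H)) \<longlongrightarrow> 0) (finite_subsets_at_top A)"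
      using tendsto_mult_right_zero[OF tendsto_mult_left_zero[OF lim, of ?H], of B] by simp
    show "\<forall>\<^sub>F F in finite_subsets_at_top A.
        norm ((\<Sum>a\<in>F. \<integral>x. T (g a x) * h x \<partial>lebesgue) - (\<integral>x. T (S x) * h x \<partial>lebesgue))
        \<le> B * (L2_norm (\<lambda>x. (\<Sum>a\<in>F. g a x) - S x) * ?H)"
    proof (rule eventually_finite_subsets_at_top_weakI)
      fix F assume F: "finite F" "F \<subseteq> A"
      have "(\<Sum>a\<in>F. \<integral>x. T (g a x) * h x \<partial>lebesgue) - (\<integral>x. T (S x) * h x \<partial>lebesgue)
          = (\<integral>x. (\<Sum>a\<in>F. T (g a x) * h x) - T (S x) * h x \<partial>lebesgue)"
      proof -
        have i: "integrable lebesgue (\<lambda>x. T (g a x) * h x)" if "a \<in> F" for a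
          using that F gL by (intro P(1)) auto
        have "(\<integral>x. (\<Sum>a\<in>F. T (g a x) * h x) - T (S x) * h x \<partial>lebesgue)
            = (\<integral>x. (\<Sum>a\<in>F. T (g a x) * h x) \<partial>lebesgue) - (\<integral>x. T (S x) * h x \<partial>lebesgue)"
          by (intro Bochner_Integration.integral_diff Bochner_Integration.integrable_sum i P(1) SL)
        also have "(\<integral>x. (\<Sum>a\<in>F. T (g a x) * h x) \<partial>lebesgue) = (\<Sum>a\<in>F. \<integral>x. T (g a x) * h x \<partial>lebesgue)"
          by (rule Bochner_Integration.integral_sum[OF i])
        finally show ?thesis by simp
      qed
      also have "\<dots> = (\<integral>x. T ((\<Sum>a\<in>F. g a x) - S x) * h x \<partial>lebesgue)"
        by (simp add: T.diff T.sum sum_distrib_right left_diff_distrib)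
      finally show "norm ((\<Sum>a\<in>F. \<integral>x. T (g a x) * h x \<partial>lebesgue) - (\<integral>x. T (S x) * h x \<partial>lebesgue))
        \<le> B * (L2_norm (\<lambda>x. (\<Sum>a\<in>F. g a x) - S x) * ?H)"
      proof (simp only:, intro P(2))
        have "(\<lambda>x. (\<Sum>a\<in>F. g a x) + - S x) \<in> L2"
          using F gL SL by (intro L2_add L2_uminus L2_sum) auto
        then show "(\<lambda>x. (\<Sum>a\<in>F. g a x) - S x) \<in> L2"
          by simp
      qed
    qed
  qed
  then show ?thesis
    unfolding has_sum_def by (subst (asm) Lim_null[symmetric])
qed

section \<open>Lattice points and the extra point\<close>

lemma cis_int_period: "cis (2 * pi * of_int n * of_int m) = 1"
proof -
  have "cis (2 * pi * of_int n * of_int m) = cis (2 * pi * of_int (n * m))" by (simp add: mult.assoc)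
  also have "\<dots> = 1" by (rule cis_multiple_2pi) auto
  finally show ?thesis .
qed

text \<open>The characters are trivial at integer points, so the sum over the cells is the biorthogonality sum:
  only the translation \<open>\<beta>\<close> survives, and it leaves a Fourier coefficient of the profile.\<close>

lemma lattice_pairing:
  fixes b n \<beta> :: int
  assumes \<phi>: "cell_profile \<rho> \<phi>" and K: "(tail_coeff has_sum K) UNIV"
  shows "(\<integral>x. gauss_atom (of_int b) (of_int n) x * dual_test \<beta> \<phi> x \<partial>lborel) =
    (if b = \<beta> then of_real K * cell_fourier \<phi> (of_int n) else 0)"
proof -
  have 1: "(\<lambda>m. (exp (2 * pi * (real_of_int b - of_int \<beta>) * of_int m) * tail_coeff m) *\<^sub>R cis (2 * pi * of_int n * of_int m))
      = (\<lambda>m. complex_of_real (exp (2 * pi * real_of_int (b - \<beta>) * of_int m) * tail_coeff m))"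
    unfolding cis_int_period scaleR_conv_of_real by simp
  show ?thesis
  proof (cases "b = \<beta>")
    case True
    have "((\<lambda>m. complex_of_real (exp (2 * pi * real_of_int (b - \<beta>) * of_int m) * tail_coeff m)) has_sum of_real K) UNIV"
      using has_sum_of_real[OF K] True by simp
    from integral_gauss_atom_dual_test[OF \<phi>, of "of_int b" \<beta> "of_int n", unfolded 1, OF this] show ?thesis
      using True cis_int_period[of n \<beta>] by (simp add: cell_fourier_def)
  next
    case False
    have "((\<lambda>m. complex_of_real (exp (2 * pi * real_of_int (b - \<beta>) * of_int m) * tail_coeff m)) has_sum of_real 0) UNIV"
      using False by (intro has_sum_of_real tail_coeff_biorthogonal) simp
    from integral_gauss_atom_dual_test[OF \<phi>, of "of_int b" \<beta> "of_int n", unfolded 1, OF this] show ?thesis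
      using False by simp
  qed
qed

text \<open>The cut-off carries the character inverse to the one of frequency \<open>\<tau>\<close>, which makes the pairing with an
  atom of frequency \<open>\<tau>\<close> the integral of a positive function.\<close>

definition modulated_indicator :: "real \<Rightarrow> real \<Rightarrow> real \<Rightarrow> real \<Rightarrow> complex"
  where "modulated_indicator l r \<tau> y = indicator {l..r} y *\<^sub>R cis (- (2 * pi * \<tau> * y))"

lemma cell_profile_modulated_indicator:
  assumes "\<bar>l\<bar> \<le> \<rho>" "\<bar>r\<bar> \<le> \<rho>" "\<rho> < 1/2"
  shows "cell_profile \<rho> (modulated_indicator l r \<tau>)"
proof -
  have "(\<lambda>y. cis (- (2 * pi * \<tau> * y))) \<in> borel_measurable borel"
    by (intro borel_measurable_continuous_onI continuous_intros)
  then have "modulated_indicator l r \<tau> \<in> borel_measurable borel"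
    unfolding modulated_indicator_def by measurable
  then show ?thesis
    using assms by (auto simp: cell_profile_def modulated_indicator_def indicator_def)
qed

lemma modulated_indicator_norm_sq:
  assumes "l \<le> r"
  shows "(\<integral>y. (norm (modulated_indicator l r \<tau> y))\<^sup>2 \<partial>lborel) = r - l"
proof -
  have "(norm (modulated_indicator l r \<tau> y))\<^sup>2 = indicator {l..r} y" for y
    by (simp add: modulated_indicator_def indicator_def)
  then show ?thesis using assms by simp
qed

lemma cis_half_int:
  assumes "\<tau> = 1/2 \<or> \<tau> = -1/2"
  shows "cis (2 * pi * \<tau> * of_int m) = of_real ((-1) ^ nat \<bar>m\<bar>)"
proof -
  have 1: "cis (pi * of_int m) = of_real ((-1) ^ nat \<bar>m\<bar>)" for m :: int
    by (cases m rule: int_cases2) (simp_all add: complex_eq_iff)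
  from assms show ?thesis
  proof
    assume \<tau>: "\<tau> = 1/2"
    show ?thesis using 1[of m] unfolding \<tau> by simp
  next
    assume \<tau>: "\<tau> = -1/2"
    show ?thesis using 1[of "- m"] unfolding \<tau> by simp
  qed
qed

text \<open>At the extra point the modulation by \<open>\<plusminus>1/2\<close> contributes the sign \<open>(-1)^m\<close> on the cell \<open>m\<close>, which is
  the sign of Bastiaans' window there. Nothing cancels in the sum over the cells, so it is bounded
  below by the term with index \<open>-\<beta>\<close>, which comes from the cell around \<open>0\<close>; the
  remaining exponential is bounded below by its value at the end \<open>y0\<close> of the interval where it is smallest.\<close>

lemma extra_pairing_lower_bound:
  assumes \<rho>: "\<bar>l\<bar> \<le> \<rho>" "\<bar>r\<bar> \<le> \<rho>" "\<rho> < 1/2" and lr: "l \<le> r"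
    and \<tau>: "\<tau> = 1/2 \<or> \<tau> = -1/2"
    and y0: "\<And>y. l \<le> y \<Longrightarrow> y \<le> r \<Longrightarrow> (1/2 - real \<beta>) * y0 \<le> (1/2 - real \<beta>) * y"
  shows "exp (pi * ((real \<beta>)\<^sup>2 - 1/4) + 2 * pi * ((1/2 - real \<beta>) * y0)) * alt_gauss_tail \<beta> * (r - l)
    \<le> norm (\<integral>x. gauss_atom (1/2) \<tau> x * dual_test (int \<beta>) (modulated_indicator l r \<tau>) x \<partial>lborel)"
proof -
  let ?t = "1/2 - real \<beta>"
  let ?g = "\<lambda>m::int. exp (2 * pi * ?t * of_int m) * \<bar>tail_coeff m\<bar>"
  define Z where "Z = infsum ?g UNIV"
  have Z: "(?g has_sum Z) UNIV"
    unfolding Z_def using abs_summable_exp_tail_coeff[of ?t] by (rule has_sum_infsum)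
  have "?g (- int \<beta>) \<le> Z"
    using finite_sum_le_has_sum[OF Z, of "{- int \<beta>}"] by simp
  then have Zge: "exp (2 * pi * ?t * (- real \<beta>)) * alt_gauss_tail \<beta> \<le> Z"
    by (simp add: abs_tail_coeff)
  have Z0: "0 \<le> Z" unfolding Z_def by (rule infsum_nonneg) simp
  have sgn: "(exp (2 * pi * (1/2 - of_int (int \<beta>)) * of_int m) * tail_coeff m) *\<^sub>R cis (2 * pi * \<tau> * of_int m) = complex_of_real (?g m)" for m
  proof -
    have "\<bar>tail_coeff m\<bar> = tail_coeff m * (-1) ^ nat \<bar>m\<bar>"
      unfolding abs_tail_coeff by (simp add: tail_coeff_def minus_one_power_iff)
    then show ?thesis
      unfolding cis_half_int[OF \<tau>] by (simp add: scaleR_conv_of_real)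
  qed
  have S: "((\<lambda>m. (exp (2 * pi * (1/2 - of_int (int \<beta>)) * of_int m) * tail_coeff m) *\<^sub>R cis (2 * pi * \<tau> * of_int m)) has_sum complex_of_real Z) UNIV"
    unfolding sgn by (rule has_sum_of_real[OF Z])
  let ?J = "\<lambda>y. indicator {l..r} y *\<^sub>R exp (2 * pi * ?t * y)"
  have J: "exp (2 * pi * ?t * y) *\<^sub>R cis (2 * pi * \<tau> * y) * modulated_indicator l r \<tau> y = complex_of_real (?J y)" for y
    by (simp add: modulated_indicator_def scaleR_conv_of_real cis_mult)
  have "integrable lborel (\<lambda>y. indicator {l..r} y *\<^sub>R exp (2 * pi * (?t * y0)))"
    by (rule borel_integrable_compact) auto
  moreover have Jint: "integrable lborel ?J"
    by (rule borel_integrable_compact) (auto intro!: continuous_intros)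
  ultimately have "(\<integral>y. indicator {l..r} y *\<^sub>R exp (2 * pi * (?t * y0)) \<partial>lborel) \<le> (\<integral>y. ?J y \<partial>lborel)"
    by (rule integral_mono) (use y0 in \<open>auto simp: indicator_def mult.assoc\<close>)
  then have Jge: "(r - l) * exp (2 * pi * (?t * y0)) \<le> (\<integral>y. ?J y \<partial>lborel)"
    using lr by simp
  have "exp (- pi * ?t\<^sup>2) * (exp (2 * pi * ?t * (- real \<beta>)) * alt_gauss_tail \<beta>) * ((r - l) * exp (2 * pi * (?t * y0)))
      \<le> exp (- pi * ?t\<^sup>2) * Z * (\<integral>y. ?J y \<partial>lborel)"
    using lr alt_gauss_tail_nonneg by (intro mult_mono Zge Jge) (auto intro!: mult_nonneg_nonneg Z0)
  also have "exp (- pi * ?t\<^sup>2) * (exp (2 * pi * ?t * (- real \<beta>)) * alt_gauss_tail \<beta>) * ((r - l) * exp (2 * pi * (?t * y0)))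
      = exp (- pi * ?t\<^sup>2 + 2 * pi * ?t * (- real \<beta>) + 2 * pi * (?t * y0)) * alt_gauss_tail \<beta> * (r - l)"
    unfolding exp_add by simp
  also have "- pi * ?t\<^sup>2 + 2 * pi * ?t * (- real \<beta>) = pi * ((real \<beta>)\<^sup>2 - 1/4)"
    by (simp add: power2_eq_square algebra_simps)
  also have "exp (- pi * ?t\<^sup>2) * Z * (\<integral>y. ?J y \<partial>lborel)
      \<le> norm (\<integral>x. gauss_atom (1/2) \<tau> x * dual_test (int \<beta>) (modulated_indicator l r \<tau>) x \<partial>lborel)"
  proof -
    have "(\<integral>y. exp (2 * pi * (1/2 - of_int (int \<beta>)) * y) *\<^sub>R cis (2 * pi * \<tau> * y) * modulated_indicator l r \<tau> y \<partial>lborel)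
        = complex_of_real (\<integral>y. ?J y \<partial>lborel)"
      unfolding of_int_of_nat_eq J by (rule integral_complex_of_real)
    then show ?thesis
      unfolding integral_gauss_atom_dual_test[OF cell_profile_modulated_indicator[OF \<rho>] S]
      using Z0 by (simp add: norm_mult abs_mult mult_left_mono)
  qed
  finally show ?thesis .
qed

text \<open>On an interval of length comparable to \<open>1/\<beta>\<close> at distance comparable to \<open>1/\<beta>\<close> from the end \<open>-1/2\<close> of
  the cell, the integrand stays above a constant that does not depend on \<open>\<beta>\<close>: the decay
  \<open>exp (-2\<pi>\<beta>\<epsilon>)\<close> of the dual window at distance \<open>\<epsilon>\<close> from the end of the cell is harmless for \<open>\<epsilon>\<close> of
  size \<open>1/\<beta>\<close>. This slow decay reflects the zero of the Zak transform of the Gaussian.\<close>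

lemma extra_pairing_boundary:
  assumes \<beta>: "\<beta> \<ge> 1" and \<tau>: "\<tau> = 1/2 \<or> \<tau> = -1/2"
  defines "l \<equiv> - 1/2 + 1 / (2 * (real \<beta> + 1))" and "r \<equiv> - 1/2 + 1 / (real \<beta> + 1)"
  shows "exp (- 3 * pi) / (4 * (real \<beta> + 1)) \<le> norm (\<integral>x. gauss_atom (1/2) \<tau> x * dual_test (int \<beta>) (modulated_indicator l r \<tau>) x \<partial>lborel)"
proof -
  define d where "d = 1 / (real \<beta> + 1)"
  have d: "0 < d" "d \<le> 1/2" using \<beta> by (auto simp: d_def field_simps)
  have l: "l = - 1/2 + d / 2" and r: "r = - 1/2 + d" by (auto simp: l_def r_def d_def)
  have rho: "\<bar>l\<bar> \<le> 1/2 - d/2" "\<bar>r\<bar> \<le> 1/2 - d/2" "1/2 - d/2 < 1/2"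
    using d by (auto simp: l r)
  have y0: "(1/2 - real \<beta>) * r \<le> (1/2 - real \<beta>) * y" if "y \<le> r" for y
    using \<beta> that by (intro mult_left_mono_neg) auto
  have "exp (- 3 * pi) * (d / 4) \<le> exp (pi * ((real \<beta>)\<^sup>2 - 1/4) + 2 * pi * ((1/2 - real \<beta>) * r)) *
      (exp (- pi * (real \<beta> + 1/2)\<^sup>2) / 2) * (d / 2)"
  proof -
    have "d * (real \<beta> + 1) = 1" by (simp add: d_def)
    then have "real \<beta> * d \<le> 1" using d by (simp add: algebra_simps)
    then have "(2 * real \<beta> - 1) * d \<le> 2" using d by (simp add: algebra_simps)
    then have "- 3 \<le> - 1 - (2 * real \<beta> - 1) * d" by simp
    from mult_left_mono[OF this pi_ge_zero]
    have "pi * (-3) \<le> pi * (- 1 - (2 * real \<beta> - 1) * d)" .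
    also have "\<dots> = pi * ((real \<beta>)\<^sup>2 - 1/4) + 2 * pi * ((1/2 - real \<beta>) * r) + - pi * (real \<beta> + 1/2)\<^sup>2"
      by (simp add: r power2_eq_square algebra_simps)
    finally have "exp (- 3 * pi) \<le> exp (pi * ((real \<beta>)\<^sup>2 - 1/4) + 2 * pi * ((1/2 - real \<beta>) * r) + - pi * (real \<beta> + 1/2)\<^sup>2)"
      by simp
    then have "exp (- 3 * pi) * (d / 4) \<le> exp (pi * ((real \<beta>)\<^sup>2 - 1/4) + 2 * pi * ((1/2 - real \<beta>) * r) + - pi * (real \<beta> + 1/2)\<^sup>2) * (d / 4)"
      by (rule mult_right_mono) (use d in simp)
    then show ?thesis by (simp only: exp_add)
  qed
  also have "\<dots> \<le> exp (pi * ((real \<beta>)\<^sup>2 - 1/4) + 2 * pi * ((1/2 - real \<beta>) * r)) * alt_gauss_tail \<beta> * (r - l)"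
    using d by (intro mult_mono alt_gauss_tail_half) (auto simp: l r alt_gauss_tail_nonneg)
  also have "\<dots> \<le> norm (\<integral>x. gauss_atom (1/2) \<tau> x * dual_test (int \<beta>) (modulated_indicator l r \<tau>) x \<partial>lborel)"
  proof (rule extra_pairing_lower_bound[OF rho _ \<tau>])
    show "l \<le> r" using d by (simp add: l r)
  qed (rule y0)
  finally show ?thesis by (simp add: d_def field_simps)
qed

lemma extra_pairing_nonzero:
  assumes \<tau>: "\<tau> = 1/2 \<or> \<tau> = -1/2"
  shows "0 < norm (\<integral>x. gauss_atom (1/2) \<tau> x * dual_test 0 (modulated_indicator (-1/4) (1/4) \<tau>) x \<partial>lborel)"
proof -
  have "0 < alt_gauss_tail 0" using alt_gauss_tail_half[of 0] by (rule less_le_trans[rotated]) simp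
  then have "0 < exp (pi * ((real 0)\<^sup>2 - 1/4) + 2 * pi * ((1/2 - real 0) * (-1/4))) * alt_gauss_tail 0 * (1/4 - (-1/4))"
    by simp
  also have "\<dots> \<le> norm (\<integral>x. gauss_atom (1/2) \<tau> x * dual_test (int 0) (modulated_indicator (-1/4) (1/4) \<tau>) x \<partial>lborel)"
    by (rule extra_pairing_lower_bound[where \<rho> = "1/4", OF _ _ _ _ \<tau>]) auto
  finally show ?thesis by simp
qed

lemma cell_fourier_modulated_indicator:
  assumes "l \<le> r"
  shows "cell_fourier (modulated_indicator l r \<tau>) \<tau> = of_real (r - l)"
proof -
  have "cis (2 * pi * \<tau> * y) * modulated_indicator l r \<tau> y = complex_of_real (indicator {l..r} y)" for y
    by (simp add: modulated_indicator_def scaleR_conv_of_real cis_mult)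
  then have "cell_fourier (modulated_indicator l r \<tau>) \<tau> = complex_of_real (\<integral>y. indicator {l..r} y \<partial>lborel)"
    unfolding cell_fourier_def by (simp only: integral_complex_of_real)
  then show ?thesis using assms by simp
qed

section \<open>Uniqueness for complex coefficients\<close>

lemma Bessel_tensor:
  fixes \<sigma> :: int
  assumes \<phi>: "cell_profile \<rho>1 \<phi>1" "cell_profile \<rho>2 \<phi>2" and \<sigma>: "\<sigma> = 1 \<or> \<sigma> = -1" and F: "finite F"
  shows "(\<Sum>(m, n)\<in>F. (norm (cell_fourier \<phi>1 (of_int m) * cell_fourier \<phi>2 (of_int (\<sigma> * n))))\<^sup>2)
    \<le> (\<integral>y. (norm (\<phi>1 y))\<^sup>2 \<partial>lborel) * (\<integral>y. (norm (\<phi>2 y))\<^sup>2 \<partial>lborel)"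
proof -
  have inj: "inj_on ((*) \<sigma>) G" for G using \<sigma> by (auto simp: inj_on_def)
  have B2: "(\<Sum>n\<in>G. (norm (cell_fourier \<phi>2 (of_int (\<sigma> * n))))\<^sup>2) \<le> (\<integral>y. (norm (\<phi>2 y))\<^sup>2 \<partial>lborel)"
    if "finite G" for G
    using Bessel_cell_fourier[OF \<phi>(2), of "(*) \<sigma> ` G"] that by (simp add: sum.reindex[OF inj] o_def)
  show ?thesis
    unfolding norm_mult power_mult_distrib
    by (rule sum_product_le) (use Bessel_cell_fourier[OF \<phi>(1)] B2 F in auto)
qed

text \<open>Cauchy--Schwarz and Bessel turn each relation \<open>E\<close> into an inequality between \<open>\<bar>v\<bar>\<^sup>2\<close> and the energy
  \<open>N \<beta>\<close> of the coefficients over the translation \<open>\<beta>\<close>. With the profiles of \<open>extra_pairing_boundary\<close>,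
  whose pairing is at least of order \<open>1/\<beta>\<close> and whose squared norm is of order \<open>1/\<beta>\<close>, it reads
  \<open>N (\<beta>, 0) \<ge> C/\<beta>\<close> with \<open>C\<close> proportional to \<open>\<bar>v\<bar>\<^sup>2\<close>. Since the total energy is finite and the
  harmonic series diverges, \<open>v = 0\<close>. After that, the coefficients over each translation are
  orthogonal to the Fourier coefficients of all products of profiles, and profiles that approach a character on
  the whole cell isolate a single coefficient.\<close>

lemma scalar_uniqueness:
  fixes a :: "int \<times> int \<Rightarrow> int \<times> int \<Rightarrow> complex" and v :: complex and \<sigma> :: int
  assumes summ: "(\<lambda>(\<beta>, \<omega>). (norm (a \<beta> \<omega>))\<^sup>2) summable_on UNIV"
    and \<sigma>: "\<sigma> = 1 \<or> \<sigma> = -1" and K: "K > 0"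
    and E: "\<And>\<beta>1 \<beta>2 \<rho>1 \<rho>2 \<phi>1 \<phi>2. cell_profile \<rho>1 \<phi>1 \<Longrightarrow> cell_profile \<rho>2 \<phi>2 \<Longrightarrow>
      ((\<lambda>\<omega>. a (\<beta>1, \<beta>2) \<omega> * ((of_real K * cell_fourier \<phi>1 (of_int (fst \<omega>))) * (of_real K * cell_fourier \<phi>2 (of_int (\<sigma> * snd \<omega>)))))
        has_sum (- (v * ((\<integral>x. gauss_atom (1/2) (1/2) x * dual_test \<beta>1 \<phi>1 x \<partial>lborel)
          * (\<integral>x. gauss_atom (1/2) (of_int \<sigma> / 2) x * dual_test \<beta>2 \<phi>2 x \<partial>lborel))))) UNIV"
  shows "a \<beta> \<omega> = 0"
proof -
  define N where "N \<beta> = (\<Sum>\<^sub>\<infinity>\<omega>. (norm (a \<beta> \<omega>))\<^sup>2)" for \<beta>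
  have summ': "(\<lambda>(\<beta>, \<omega>). (norm (a \<beta> \<omega>))\<^sup>2) summable_on UNIV \<times> UNIV" using summ by simp
  have Ns: "(\<lambda>\<omega>. (norm (a \<beta> \<omega>))\<^sup>2) summable_on UNIV" for \<beta>
    using summable_on_SigmaD1[OF summ', of \<beta>] by simp
  have NF: "(\<Sum>\<omega>\<in>F. (norm (a \<beta> \<omega>))\<^sup>2) \<le> N \<beta>" if "finite F" for F \<beta>
    unfolding N_def by (rule finite_sum_le_infsum[OF Ns that]) auto
  have N0: "0 \<le> N \<beta>" for \<beta> using NF[of "{}"] by simp
  have Nsumm: "N summable_on UNIV"
    unfolding N_def using summable_on_Sigma_banach[OF summ'] by simp
  have \<tau>: "of_int \<sigma> / 2 = (1/2 :: real) \<or> of_int \<sigma> / 2 = - 1 / (2 :: real)" using \<sigma> by auto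
  have CS: "(norm v)\<^sup>2 * (norm (\<integral>x. gauss_atom (1/2) (1/2) x * dual_test \<beta>1 \<phi>1 x \<partial>lborel))\<^sup>2
        * (norm (\<integral>x. gauss_atom (1/2) (of_int \<sigma> / 2) x * dual_test \<beta>2 \<phi>2 x \<partial>lborel))\<^sup>2
      \<le> N (\<beta>1, \<beta>2) * (K ^ 4 * ((\<integral>y. (norm (\<phi>1 y))\<^sup>2 \<partial>lborel) * (\<integral>y. (norm (\<phi>2 y))\<^sup>2 \<partial>lborel)))"
    if \<phi>: "cell_profile \<rho>1 \<phi>1" "cell_profile \<rho>2 \<phi>2" for \<beta>1 \<beta>2 \<rho>1 \<rho>2 \<phi>1 \<phi>2
  proof -
    have "(\<Sum>\<omega>\<in>F. (norm ((of_real K * cell_fourier \<phi>1 (of_int (fst \<omega>))) * (of_real K * cell_fourier \<phi>2 (of_int (\<sigma> * snd \<omega>)))))\<^sup>2)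
        \<le> K ^ 4 * ((\<integral>y. (norm (\<phi>1 y))\<^sup>2 \<partial>lborel) * (\<integral>y. (norm (\<phi>2 y))\<^sup>2 \<partial>lborel))" if "finite F" for F
    proof -
      have "(\<Sum>\<omega>\<in>F. (norm ((of_real K * cell_fourier \<phi>1 (of_int (fst \<omega>))) * (of_real K * cell_fourier \<phi>2 (of_int (\<sigma> * snd \<omega>)))))\<^sup>2)
          = K ^ 4 * (\<Sum>(m, n)\<in>F. (norm (cell_fourier \<phi>1 (of_int m) * cell_fourier \<phi>2 (of_int (\<sigma> * n))))\<^sup>2)"
        by (simp add: sum_distrib_left case_prod_unfold norm_mult power_mult_distrib algebra_simps flip: power_add)
      also have "\<dots> \<le> K ^ 4 * ((\<integral>y. (norm (\<phi>1 y))\<^sup>2 \<partial>lborel) * (\<integral>y. (norm (\<phi>2 y))\<^sup>2 \<partial>lborel))"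
        by (intro mult_left_mono Bessel_tensor[OF \<phi> \<sigma> that]) simp
      finally show ?thesis .
    qed
    with NF[of _ "(\<beta>1, \<beta>2)"]
    have "(norm (- (v * ((\<integral>x. gauss_atom (1/2) (1/2) x * dual_test \<beta>1 \<phi>1 x \<partial>lborel)
          * (\<integral>x. gauss_atom (1/2) (of_int \<sigma> / 2) x * dual_test \<beta>2 \<phi>2 x \<partial>lborel)))))\<^sup>2
        \<le> N (\<beta>1, \<beta>2) * (K ^ 4 * ((\<integral>y. (norm (\<phi>1 y))\<^sup>2 \<partial>lborel) * (\<integral>y. (norm (\<phi>2 y))\<^sup>2 \<partial>lborel)))"
      by (rule has_sum_Cauchy_Schwarz[OF E[OF \<phi>]])
    then show ?thesis by (simp add: norm_mult power_mult_distrib mult_ac)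
  qed
  have v: "v = 0"
  proof (rule ccontr)
    assume "v \<noteq> 0"
    define p where "p = norm (\<integral>x. gauss_atom (1/2) (of_int \<sigma> / 2) x * dual_test 0 (modulated_indicator (-1/4) (1/4) (of_int \<sigma> / 2)) x \<partial>lborel)"
    have p: "p > 0" unfolding p_def by (rule extra_pairing_nonzero[OF \<tau>])
    define C where "C = (norm v)\<^sup>2 * (exp (- 3 * pi) / 4)\<^sup>2 * p\<^sup>2 / (K ^ 4 / 4)"
    have C: "C > 0" using \<open>v \<noteq> 0\<close> p K by (simp add: C_def)
    have lower: "C * inverse (real \<beta> + 1) \<le> N (int \<beta>, 0)" if \<beta>: "\<beta> \<ge> 1" for \<beta>
    proof -
      define l r where "l = - 1/2 + 1 / (2 * (real \<beta> + 1))" and "r = - 1/2 + 1 / (real \<beta> + 1)"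
      have d: "0 < 1 / (real \<beta> + 1)" "1 / (real \<beta> + 1) \<le> 1/2" using \<beta> by (auto simp: field_simps)
      have lr: "r - l = 1 / (2 * (real \<beta> + 1))"
      proof -
        have "1 / e - 1 / (2 * e) = 1 / (2 * e)" if "e \<noteq> 0" for e :: real
          using that by (simp add: field_simps)
        from this[of "real \<beta> + 1"] show ?thesis by (simp add: l_def r_def)
      qed
      have \<phi>1: "cell_profile (1/2 - 1 / (2 * (real \<beta> + 1))) (modulated_indicator l r (1/2))"
      proof -
        have "cell_profile (1/2 - e/2) (modulated_indicator (- 1/2 + e/2) (- 1/2 + e) (1/2))" if "0 < e" "e \<le> 1/2" for e
          by (rule cell_profile_modulated_indicator) (use that in auto)
        from this[OF d] show ?thesis by (simp add: l_def r_def mult.commute)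
      qed
      have \<phi>2: "cell_profile (1/4) (modulated_indicator (-1/4) (1/4) (of_int \<sigma> / 2))"
        by (intro cell_profile_modulated_indicator) auto
      have "0 \<le> r - l" unfolding lr by simp
      then have "l \<le> r" by simp
      have "(norm v)\<^sup>2 * (exp (- 3 * pi) / (4 * (real \<beta> + 1)))\<^sup>2 * p\<^sup>2
          \<le> (norm v)\<^sup>2 * (norm (\<integral>x. gauss_atom (1/2) (1/2) x * dual_test (int \<beta>) (modulated_indicator l r (1/2)) x \<partial>lborel))\<^sup>2 * p\<^sup>2"
        unfolding l_def r_def
        by (intro mult_right_mono mult_left_mono power_mono extra_pairing_boundary \<beta>) auto
      also have "\<dots> \<le> N (int \<beta>, 0) * (K ^ 4 * ((r - l) * (1/2)))"
      proof -
        have half: "(\<integral>y. (norm (modulated_indicator (-1/4) (1/4) (of_int \<sigma> / 2) y))\<^sup>2 \<partial>lborel) = 1/2"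
          by (subst modulated_indicator_norm_sq) auto
        show ?thesis
          using CS[OF \<phi>1 \<phi>2, of "int \<beta>" 0] unfolding p_def modulated_indicator_norm_sq[OF \<open>l \<le> r\<close>] half .
      qed
      also have "\<dots> = N (int \<beta>, 0) * (K ^ 4 / 4) / (real \<beta> + 1)"
        by (simp add: lr)
      finally have "((norm v)\<^sup>2 * (exp (- 3 * pi) / 4)\<^sup>2 * p\<^sup>2 / (real \<beta> + 1)) / (real \<beta> + 1)
          \<le> N (int \<beta>, 0) * (K ^ 4 / 4) / (real \<beta> + 1)"
        by (simp add: power_divide power_mult_distrib power2_eq_square field_simps)
      then have "(norm v)\<^sup>2 * (exp (- 3 * pi) / 4)\<^sup>2 * p\<^sup>2 / (real \<beta> + 1) \<le> N (int \<beta>, 0) * (K ^ 4 / 4)"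
        unfolding divide_le_cancel by simp
      moreover have "0 < K ^ 4 / 4" using K by simp
      ultimately have "((norm v)\<^sup>2 * (exp (- 3 * pi) / 4)\<^sup>2 * p\<^sup>2 / (real \<beta> + 1)) / (K ^ 4 / 4) \<le> N (int \<beta>, 0)"
        by (simp only: pos_divide_le_eq)
      moreover have "x / k * inverse e = x / e / k" for x k e :: real
        by (simp add: divide_inverse)
      ultimately show ?thesis unfolding C_def by (simp only:)
    qed
    have "N summable_on range (\<lambda>\<beta>. (int \<beta>, 0))"
      by (rule summable_on_subset[OF Nsumm]) simp
    then have "(\<lambda>\<beta>. N (int \<beta>, 0)) summable_on UNIV"
      by (subst (asm) summable_on_reindex) (auto simp: inj_on_def o_def)
    then have "summable (\<lambda>\<beta>. N (int \<beta>, 0))" by (rule summable_on_imp_summable)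
    then have "summable (\<lambda>\<beta>. C * inverse (real \<beta> + 1))"
      by (rule summable_comparison_test_ev[rotated])
         (use lower C in \<open>auto simp: eventually_at_top_linorder intro!: exI[of _ 1]\<close>)
    then have "summable (\<lambda>\<beta>. inverse (real \<beta> + 1))"
      using C by (subst (asm) summable_cmult_iff) simp
    then have "summable (\<lambda>\<beta>. inverse (real (Suc \<beta>)))" by (simp add: add.commute)
    then have "summable (\<lambda>\<beta>. inverse (real \<beta>))" by (subst (asm) summable_Suc_iff)
    then show False using not_summable_harmonic[where ?'a = real] by simp
  qed
  obtain m n where \<omega>: "\<omega> = (m, n)" by (cases \<omega>)
  obtain \<beta>1 \<beta>2 where \<beta>: "\<beta> = (\<beta>1, \<beta>2)" by (cases \<beta>)
  \<comment> \<open>The two profiles have Fourier coefficient \<open>d\<close> at the chosen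
    characters and squared norm \<open>d\<close>. By Bessel's inequality, their tensor product has
    energy at most \<open>d\<^sup>2 - d ^ 4\<close> at all other characters, which tends to
    \<open>0\<close> as \<open>d\<close> tends to \<open>1\<close>.\<close>
  have bound: "(norm (a \<beta> \<omega>))\<^sup>2 * d ^ 4 \<le> N \<beta> * (d\<^sup>2 - d ^ 4)" if d: "0 < d" "d < 1" for d :: real
  proof -
    let ?\<phi>1 = "modulated_indicator (- d/2) (d/2) (of_int m)" and ?\<phi>2 = "modulated_indicator (- d/2) (d/2) (of_int (\<sigma> * n))"
    let ?w = "\<lambda>\<omega>. cell_fourier ?\<phi>1 (of_int (fst \<omega>)) * cell_fourier ?\<phi>2 (of_int (\<sigma> * snd \<omega>))"
    have \<phi>: "cell_profile (d/2) ?\<phi>1" "cell_profile (d/2) ?\<phi>2"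
      using d by (auto intro!: cell_profile_modulated_indicator)
    have w0: "?w \<omega> = of_real (d\<^sup>2)"
      using d cell_fourier_modulated_indicator[of "- d/2" "d/2" "of_int m"] cell_fourier_modulated_indicator[of "- d/2" "d/2" "of_int (\<sigma> * n)"]
      by (simp add: \<omega> power2_eq_square)
    have "((\<lambda>\<omega>. (a \<beta> \<omega> * ?w \<omega>) * of_real (K\<^sup>2)) has_sum 0 * of_real (K\<^sup>2)) UNIV"
      using E[OF \<phi>, of \<beta>1 \<beta>2] by (simp add: v \<beta> power2_eq_square mult_ac)
    then have s0: "((\<lambda>\<omega>. a \<beta> \<omega> * ?w \<omega>) has_sum 0) UNIV"
      using K by (subst (asm) has_sum_cmult_left_iff) auto
    have "((\<lambda>\<omega>. a \<beta> \<omega> * ?w \<omega>) has_sum (0 - a \<beta> \<omega> * ?w \<omega>)) (UNIV - {\<omega>})"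
      by (rule has_sum_Diff[OF s0 has_sum_finiteI]) auto
    then have "(norm (0 - a \<beta> \<omega> * ?w \<omega>))\<^sup>2 \<le> N \<beta> * (d\<^sup>2 - d ^ 4)"
    proof (rule has_sum_Cauchy_Schwarz)
      fix F assume F: "finite F" "F \<subseteq> UNIV - {\<omega>}"
      show "(\<Sum>\<omega>\<in>F. (norm (a \<beta> \<omega>))\<^sup>2) \<le> N \<beta>" by (rule NF[OF F(1)])
      have "(\<Sum>\<omega>\<in>insert \<omega> F. (norm (?w \<omega>))\<^sup>2) \<le> d * d"
        using Bessel_tensor[OF \<phi> \<sigma>, of "insert \<omega> F"] F modulated_indicator_norm_sq[of "- d/2" "d/2"] d
        by (simp add: case_prod_unfold)
      moreover have "(\<Sum>\<omega>\<in>insert \<omega> F. (norm (?w \<omega>))\<^sup>2) = (norm (?w \<omega>))\<^sup>2 + (\<Sum>\<omega>\<in>F. (norm (?w \<omega>))\<^sup>2)"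
        using F by (intro sum.insert) auto
      moreover have "(norm (?w \<omega>))\<^sup>2 = d ^ 4"
        unfolding w0 by (simp add: norm_power power_mult[symmetric])
      ultimately show "(\<Sum>\<omega>\<in>F. (norm (?w \<omega>))\<^sup>2) \<le> d\<^sup>2 - d ^ 4"
        by (simp add: power2_eq_square)
    qed
    then show ?thesis
      unfolding w0 by (simp add: norm_mult norm_power power_mult_distrib power_mult[symmetric])
  qed
  have "((\<lambda>d. (norm (a \<beta> \<omega>))\<^sup>2 * d ^ 4) \<longlongrightarrow> (norm (a \<beta> \<omega>))\<^sup>2 * 1 ^ 4) (at_left (1::real))"
    and "((\<lambda>d. N \<beta> * (d\<^sup>2 - d ^ 4)) \<longlongrightarrow> N \<beta> * (1\<^sup>2 - 1 ^ 4)) (at_left (1::real))"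
    by (intro tendsto_intros)+
  moreover have "\<forall>\<^sub>F d in at_left (1::real). (norm (a \<beta> \<omega>))\<^sup>2 * d ^ 4 \<le> N \<beta> * (d\<^sup>2 - d ^ 4)"
    using eventually_at_left_real[of 0 1] by (rule eventually_mono) (use bound in auto)
  ultimately have "(norm (a \<beta> \<omega>))\<^sup>2 * 1 ^ 4 \<le> N \<beta> * (1\<^sup>2 - 1 ^ 4)"
    by (intro tendsto_le[of "at_left (1::real)"]) auto
  then show ?thesis by simp
qed

section \<open>From quaternions to complex numbers\<close>

text \<open>Writing \<open>q = \<alpha> + \<beta> j\<close> with complex \<open>\<alpha>\<close> and \<open>\<beta>\<close>, this is \<open>\<alpha> + \<sigma> i \<beta>\<close>. For \<open>\<sigma> = \<plusminus>1\<close> these are the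
  joint eigenfunctionals of left multiplication by \<open>i\<close> and right multiplication by \<open>j\<close>, with
  eigenvalues \<open>i\<close> and \<open>\<sigma> i\<close>.\<close>

definition bimodule_proj :: "int \<Rightarrow> quat \<Rightarrow> complex"
  where "bimodule_proj \<sigma> q = Complex (qre q - of_int \<sigma> * qim3 q) (qim1 q + of_int \<sigma> * qim2 q)"

lemma bounded_linear_bimodule_proj: "bounded_linear (bimodule_proj \<sigma>)"
  by (rule linear_conv_bounded_linear[THEN iffD1], rule linearI)
     (auto simp: bimodule_proj_def complex_eq_iff algebra_simps)

lemma norm_bimodule_proj_sq:
  assumes "\<sigma> = 1 \<or> \<sigma> = -1"
  shows "(norm (bimodule_proj \<sigma> q))\<^sup>2 \<le> 2 * (norm q)\<^sup>2"
proof -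
  have "(w - of_int \<sigma> * z)\<^sup>2 + (x + of_int \<sigma> * y)\<^sup>2 \<le> 2 * (w\<^sup>2 + x\<^sup>2 + y\<^sup>2 + z\<^sup>2)" for w x y z :: real
  proof -
    have "0 \<le> (w + of_int \<sigma> * z)\<^sup>2 + (x - of_int \<sigma> * y)\<^sup>2" by simp
    moreover have "(of_int \<sigma> :: real)\<^sup>2 = 1" using assms by auto
    ultimately show ?thesis by (simp add: power2_sum power2_diff power_mult_distrib)
  qed
  then show ?thesis
    by (simp add: bimodule_proj_def cmod_power2 norm_quat_def)
qed

lemma norm_bimodule_proj:
  assumes "\<sigma> = 1 \<or> \<sigma> = -1"
  shows "norm (bimodule_proj \<sigma> q) \<le> 2 * norm q"
proof (rule power2_le_imp_le)
  show "(norm (bimodule_proj \<sigma> q))\<^sup>2 \<le> (2 * norm q)\<^sup>2"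
  proof -
    have "(2 * norm q)\<^sup>2 = 4 * (norm q)\<^sup>2" by (simp add: power_mult_distrib)
    then show ?thesis
      using norm_bimodule_proj_sq[OF assms, of q] zero_le_power2[of "norm q"] by linarith
  qed
qed simp

text \<open>Both exponentials become ordinary complex phases, at the price of the sign \<open>\<sigma>\<close> on the second
  frequency.\<close>

lemma bimodule_proj_exp:
  assumes "\<sigma> = 1 \<or> \<sigma> = -1"
  shows "bimodule_proj \<sigma> (exp_i s * q * of_real e * exp_j t) = of_real e * bimodule_proj \<sigma> q * cis s * cis (of_int \<sigma> * t)"
  using assms
  by (auto simp: bimodule_proj_def exp_i_def exp_j_def quat_i_def quat_j_def complex_eq_iff algebra_simps)

lemma bimodule_proj_eq_0_imp:
  assumes "bimodule_proj 1 q = 0" "bimodule_proj (-1) q = 0"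
  shows "q = 0"
  using assms by (auto simp: bimodule_proj_def complex_eq_iff quat_eq_iff)

lemma bimodule_proj_gauss_atom:
  fixes x b \<omega> :: "real^2"
  assumes "\<sigma> = 1 \<or> \<sigma> = -1"
  shows "bimodule_proj \<sigma> (exp_i (2 * pi * x $ 1 * \<omega> $ 1) * q * of_real (exp (- pi * (norm (x - b))\<^sup>2)) * exp_j (2 * pi * x $ 2 * \<omega> $ 2))
    = bimodule_proj \<sigma> q * (gauss_atom (b $ 1) (\<omega> $ 1) (x $ 1) * gauss_atom (b $ 2) (of_int \<sigma> * \<omega> $ 2) (x $ 2))"
proof -
  have "(norm (x - b))\<^sup>2 = (x $ 1 - b $ 1)\<^sup>2 + (x $ 2 - b $ 2)\<^sup>2"
    by (simp add: norm_vec_def L2_set_def UNIV_2)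
  then have "exp (- pi * (norm (x - b))\<^sup>2) = exp (- pi * (x $ 1 - b $ 1)\<^sup>2) * exp (- pi * (x $ 2 - b $ 2)\<^sup>2)"
    by (simp add: algebra_simps flip: exp_add)
  then show ?thesis
    unfolding bimodule_proj_exp[OF assms] by (simp add: gauss_atom_def scaleR_conv_of_real mult_ac)
qed

definition dual_test2 :: "int \<Rightarrow> int \<Rightarrow> (real \<Rightarrow> complex) \<Rightarrow> (real \<Rightarrow> complex) \<Rightarrow> real^2 \<Rightarrow> complex"
  where "dual_test2 \<beta>1 \<beta>2 \<phi>1 \<phi>2 x = dual_test \<beta>1 \<phi>1 (x $ 1) * dual_test \<beta>2 \<phi>2 (x $ 2)"

lemma dual_test2_L2:
  assumes "cell_profile \<rho>1 \<phi>1" "cell_profile \<rho>2 \<phi>2"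
  shows "dual_test2 \<beta>1 \<beta>2 \<phi>1 \<phi>2 \<in> borel_measurable borel"
    and "integrable lebesgue (\<lambda>x. (norm (dual_test2 \<beta>1 \<beta>2 \<phi>1 \<phi>2 x))\<^sup>2)"
proof -
  have [measurable]: "dual_test \<beta>1 \<phi>1 \<in> borel_measurable borel" "dual_test \<beta>2 \<phi>2 \<in> borel_measurable borel"
    using assms by (auto intro: dual_test_measurable)
  show m[measurable]: "dual_test2 \<beta>1 \<beta>2 \<phi>1 \<phi>2 \<in> borel_measurable borel"
    unfolding dual_test2_def by measurable
  have "integrable lborel (\<lambda>x. (norm (dual_test2 \<beta>1 \<beta>2 \<phi>1 \<phi>2 x))\<^sup>2)"
    unfolding dual_test2_def norm_mult power_mult_distrib
    by (rule integrable_tensor) (rule dual_test_square_integrable[OF assms(1)] dual_test_square_integrable[OF assms(2)])+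
  then show "integrable lebesgue (\<lambda>x. (norm (dual_test2 \<beta>1 \<beta>2 \<phi>1 \<phi>2 x))\<^sup>2)"
    by (subst integrable_completion) auto
qed

lemma dual_test2_pairing:
  fixes b \<omega> :: "real^2"
  assumes \<sigma>: "\<sigma> = 1 \<or> \<sigma> = -1" and \<phi>: "cell_profile \<rho>1 \<phi>1" "cell_profile \<rho>2 \<phi>2"
  shows "(\<integral>x. bimodule_proj \<sigma> (exp_i (2 * pi * x $ 1 * \<omega> $ 1) * q * of_real (exp (- pi * (norm (x - b))\<^sup>2)) * exp_j (2 * pi * x $ 2 * \<omega> $ 2))
        * dual_test2 \<beta>1 \<beta>2 \<phi>1 \<phi>2 x \<partial>lebesgue)
    = bimodule_proj \<sigma> q * ((\<integral>x. gauss_atom (b $ 1) (\<omega> $ 1) x * dual_test \<beta>1 \<phi>1 x \<partial>lborel)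
        * (\<integral>x. gauss_atom (b $ 2) (of_int \<sigma> * \<omega> $ 2) x * dual_test \<beta>2 \<phi>2 x \<partial>lborel))"
proof -
  let ?f1 = "\<lambda>x. gauss_atom (b $ 1) (\<omega> $ 1) x * dual_test \<beta>1 \<phi>1 x"
  let ?f2 = "\<lambda>x. gauss_atom (b $ 2) (of_int \<sigma> * \<omega> $ 2) x * dual_test \<beta>2 \<phi>2 x"
  have [measurable]: "dual_test \<beta>1 \<phi>1 \<in> borel_measurable borel" "dual_test \<beta>2 \<phi>2 \<in> borel_measurable borel"
    using \<phi> by (auto intro: dual_test_measurable)
  have eq: "bimodule_proj \<sigma> (exp_i (2 * pi * x $ 1 * \<omega> $ 1) * q * of_real (exp (- pi * (norm (x - b))\<^sup>2)) * exp_j (2 * pi * x $ 2 * \<omega> $ 2))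
        * dual_test2 \<beta>1 \<beta>2 \<phi>1 \<phi>2 x = bimodule_proj \<sigma> q * (?f1 (x $ 1) * ?f2 (x $ 2))" for x
    unfolding bimodule_proj_gauss_atom[OF \<sigma>] dual_test2_def by (simp add: mult_ac)
  have i: "integrable lborel (\<lambda>x :: real^2. ?f1 (x $ 1) * ?f2 (x $ 2))"
    by (rule integrable_tensor) (rule integrable_gauss_atom_dual_test[OF \<phi>(1)] integrable_gauss_atom_dual_test[OF \<phi>(2)])+
  have "(\<integral>x. bimodule_proj \<sigma> q * (?f1 (x $ 1) * ?f2 ((x :: real^2) $ 2)) \<partial>lebesgue)
      = bimodule_proj \<sigma> q * (\<integral>x. ?f1 (x $ 1) * ?f2 ((x :: real^2) $ 2) \<partial>lborel)"
    unfolding integral_mult_right_zero integral_completion[OF borel_measurable_integrable[OF i]] ..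
  also have "(\<integral>x. ?f1 (x $ 1) * ?f2 ((x :: real^2) $ 2) \<partial>lborel) = (\<integral>x. ?f1 x \<partial>lborel) * (\<integral>x. ?f2 x \<partial>lborel)"
    by (rule integral_tensor) (rule integrable_gauss_atom_dual_test[OF \<phi>(1)] integrable_gauss_atom_dual_test[OF \<phi>(2)])+
  finally show ?thesis unfolding eq .
qed

definition lattice_point :: "(int \<times> int) \<times> (int \<times> int) \<Rightarrow> (real^2) \<times> (real^2)"
  where "lattice_point = (\<lambda>((b1, b2), (m, n)). (vector [of_int b1, of_int b2], vector [of_int m, of_int n]))"

lemma bij_lattice_point: "bij_betw lattice_point UNIV Lattice"
proof (rule bij_betw_byWitness[where f' = "\<lambda>(b, \<omega>). ((\<lfloor>b $ 1\<rfloor>, \<lfloor>b $ 2\<rfloor>), (\<lfloor>\<omega> $ 1\<rfloor>, \<lfloor>\<omega> $ 2\<rfloor>))"])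
  show "\<forall>l\<in>Lattice. lattice_point (case l of (b, \<omega>) \<Rightarrow> ((\<lfloor>b $ 1\<rfloor>, \<lfloor>b $ 2\<rfloor>), \<lfloor>\<omega> $ 1\<rfloor>, \<lfloor>\<omega> $ 2\<rfloor>)) = l"
    by (auto simp: lattice_point_def Lattice_def vec_eq_iff forall_2)
  show "lattice_point ` UNIV \<subseteq> Lattice"
    by (auto simp: lattice_point_def Lattice_def forall_2)
qed (auto simp: lattice_point_def)

theorem theorem3:
  fixes c :: "(real^2) \<times> (real^2) \<Rightarrow> quat" and u :: quat and S :: "real^2 \<Rightarrow> quat"
  assumes "(\<lambda>l. (norm (c l))\<^sup>2) summable_on Lattice"
    and "L2_has_sum
      (\<lambda>(b, \<omega>) x. exp_i (2 * pi * x $ 1 * \<omega> $ 1) * c (b, \<omega>)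
        * of_real (exp (- pi * (norm (x - b))\<^sup>2)) * exp_j (2 * pi * x $ 2 * \<omega> $ 2))
      S Lattice"
    and "AE x in lebesgue.
      exp_i (pi * x $ 1) * u * of_real (exp (- pi * (norm (x - vector [1/2, 1/2]))\<^sup>2))
        * exp_j (pi * x $ 2) + S x = 0"
  shows "\<forall>l\<in>Lattice. c l = 0"
proof -
  obtain K where K: "K > 0" "(tail_coeff has_sum K) UNIV" using tail_coeff_total_pos by blast
  let ?g = "\<lambda>(b, \<omega>) (x :: real^2). exp_i (2 * pi * x $ 1 * \<omega> $ 1) * c (b, \<omega>)
        * of_real (exp (- pi * (norm (x - b))\<^sup>2)) * exp_j (2 * pi * x $ 2 * \<omega> $ 2)"
  have zero: "bimodule_proj \<sigma> (c (lattice_point (\<beta>, \<omega>))) = 0" if \<sigma>: "\<sigma> = 1 \<or> \<sigma> = -1" for \<sigma> \<beta> \<omega>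
  proof (rule scalar_uniqueness[where a = "\<lambda>\<beta> \<omega>. bimodule_proj \<sigma> (c (lattice_point (\<beta>, \<omega>)))" and v = "bimodule_proj \<sigma> u", OF _ \<sigma> K(1)])
    have "(\<lambda>i. 2 * (norm (c (lattice_point i)))\<^sup>2) summable_on UNIV"
      using assms(1) by (intro summable_on_cmult_right) (subst summable_on_reindex_bij_betw[OF bij_lattice_point, of "\<lambda>l. (norm (c l))\<^sup>2"])
    then have "(\<lambda>i. (norm (bimodule_proj \<sigma> (c (lattice_point i))))\<^sup>2) summable_on UNIV"
      by (rule summable_on_comparison_test) (use norm_bimodule_proj_sq[OF \<sigma>] in auto)
    then show "(\<lambda>(\<beta>, \<omega>). (norm (bimodule_proj \<sigma> (c (lattice_point (\<beta>, \<omega>)))))\<^sup>2) summable_on UNIV"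
      by (simp add: case_prod_unfold)
  next
    fix \<beta>1 \<beta>2 \<rho>1 \<rho>2 \<phi>1 \<phi>2
    assume \<phi>: "cell_profile \<rho>1 \<phi>1" "cell_profile \<rho>2 \<phi>2"
    let ?h = "dual_test2 \<beta>1 \<beta>2 \<phi>1 \<phi>2"
    let ?w = "\<lambda>\<omega>. (of_real K * cell_fourier \<phi>1 (of_int (fst \<omega>))) * (of_real K * cell_fourier \<phi>2 (of_int (\<sigma> * snd \<omega>)))"
    let ?R = "bimodule_proj \<sigma> u * ((\<integral>x. gauss_atom (1/2) (1/2) x * dual_test \<beta>1 \<phi>1 x \<partial>lborel)
          * (\<integral>x. gauss_atom (1/2) (of_int \<sigma> / 2) x * dual_test \<beta>2 \<phi>2 x \<partial>lborel))"
    interpret P: bounded_linear "bimodule_proj \<sigma>" by (rule bounded_linear_bimodule_proj)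
    have hm: "?h \<in> borel_measurable lebesgue"
      using dual_test2_L2(1)[OF \<phi>] by (simp add: measurable_completion)
    note pair = dual_test2_pairing[OF \<sigma> \<phi>]
    have "((\<lambda>l. \<integral>x. bimodule_proj \<sigma> (?g l x) * ?h x \<partial>lebesgue) has_sum (\<integral>x. bimodule_proj \<sigma> (S x) * ?h x \<partial>lebesgue)) Lattice"
      by (rule L2_has_sum_pairing[OF bounded_linear_bimodule_proj norm_bimodule_proj[OF \<sigma>] hm dual_test2_L2(2)[OF \<phi>] assms(2)])
    then have sum: "((\<lambda>i. \<integral>x. bimodule_proj \<sigma> (?g (lattice_point i) x) * ?h x \<partial>lebesgue) has_sum (\<integral>x. bimodule_proj \<sigma> (S x) * ?h x \<partial>lebesgue)) UNIV"
      by (subst has_sum_reindex_bij_betw[OF bij_lattice_point])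
    \<comment> \<open>Biorthogonality in both coordinates leaves only the translation
      \<open>(\<beta>1, \<beta>2)\<close>.\<close>
    have lattice_term: "(\<integral>x. bimodule_proj \<sigma> (?g (lattice_point (\<beta>, \<omega>)) x) * ?h x \<partial>lebesgue)
        = (if \<beta> = (\<beta>1, \<beta>2) then bimodule_proj \<sigma> (c (lattice_point (\<beta>, \<omega>))) * ?w \<omega> else 0)" for \<beta> \<omega>
    proof -
      obtain b1 b2 where \<beta>: "\<beta> = (b1, b2)" by (cases \<beta>)
      obtain m n where \<omega>: "\<omega> = (m, n)" by (cases \<omega>)
      have "of_int \<sigma> * real_of_int n = of_int (\<sigma> * n)" by simp
      then show ?thesis
        unfolding \<beta> \<omega> lattice_point_def split pair
        unfolding vector_2 lattice_pairing[OF \<phi>(1) K(2)]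
        by (simp only: lattice_pairing[OF \<phi>(2) K(2)]) simp
    qed
    \<comment> \<open>The hypothesis identifies the sum of the series with minus the extra atom.\<close>
    have total: "(\<integral>x. bimodule_proj \<sigma> (S x) * ?h x \<partial>lebesgue) = - ?R"
    proof -
      have "S \<in> borel_measurable lebesgue" using assms(2) by (simp add: L2_has_sum_def L2_def)
      then have Sm: "(\<lambda>x. bimodule_proj \<sigma> (S x) * ?h x) \<in> borel_measurable lebesgue"
        using hm by (intro borel_measurable_times borel_measurable_continuous_on[of "bimodule_proj \<sigma>"])
          (auto intro: linear_continuous_on bounded_linear_bimodule_proj)
      let ?p = "vector [1/2, 1/2] :: real^2"
      let ?G = "\<lambda>x::real^2. exp_i (2 * pi * x $ 1 * ?p $ 1) * (- u) * of_real (exp (- pi * (norm (x - ?p))\<^sup>2))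
        * exp_j (2 * pi * x $ 2 * ?p $ 2)"
      have "AE x in lebesgue. S x = ?G x"
        using assms(3)
      proof eventually_elim
        case (elim x)
        then show ?case by (simp add: eq_neg_iff_add_eq_0 add.commute)
      qed
      then have "AE x in lebesgue. bimodule_proj \<sigma> (S x) * ?h x = bimodule_proj \<sigma> (?G x) * ?h x"
        by eventually_elim simp
      moreover have "(\<lambda>x. bimodule_proj \<sigma> (?G x) * ?h x) \<in> borel_measurable lebesgue"
        unfolding bimodule_proj_gauss_atom[OF \<sigma>] using dual_test2_L2(1)[OF \<phi>]
        by (intro measurable_completion) measurable
      ultimately have "(\<integral>x. bimodule_proj \<sigma> (S x) * ?h x \<partial>lebesgue) = (\<integral>x. bimodule_proj \<sigma> (?G x) * ?h x \<partial>lebesgue)"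
        using Sm by (intro integral_cong_AE)
      also have "\<dots> = - ?R"
        unfolding pair by (simp add: P.neg)
      finally show ?thesis .
    qed
    have off: "(\<integral>x. bimodule_proj \<sigma> (?g (lattice_point i) x) * ?h x \<partial>lebesgue) = 0" if "i \<notin> range (Pair (\<beta>1, \<beta>2))" for i
    proof -
      obtain \<beta> \<omega> where i: "i = (\<beta>, \<omega>)" by (rule prod.exhaust)
      with that have "\<beta> \<noteq> (\<beta>1, \<beta>2)" by auto
      then show ?thesis unfolding i lattice_term by (simp only: if_False)
    qed
    from sum have "((\<lambda>i. \<integral>x. bimodule_proj \<sigma> (?g (lattice_point i) x) * ?h x \<partial>lebesgue) has_sum - ?R) UNIV"
      unfolding total .
    also have "?this \<longleftrightarrow> ((\<lambda>i. \<integral>x. bimodule_proj \<sigma> (?g (lattice_point i) x) * ?h x \<partial>lebesgue) has_sum - ?R) (range (Pair (\<beta>1, \<beta>2)))"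
      by (rule has_sum_cong_neutral; (rule off)?; (rule refl | blast))
    also have "\<dots> \<longleftrightarrow> ((\<lambda>\<omega>. \<integral>x. bimodule_proj \<sigma> (?g (lattice_point ((\<beta>1, \<beta>2), \<omega>)) x) * ?h x \<partial>lebesgue) has_sum - ?R) UNIV"
      by (subst has_sum_reindex) (auto simp: inj_on_def o_def)
    finally show "((\<lambda>\<omega>. bimodule_proj \<sigma> (c (lattice_point ((\<beta>1, \<beta>2), \<omega>))) * ?w \<omega>) has_sum - ?R) UNIV"
      unfolding lattice_term by simp
  qed
  show ?thesis
  proof
    fix l assume "l \<in> Lattice"
    then obtain \<beta> \<omega> where "l = lattice_point (\<beta>, \<omega>)"
      using bij_betw_imp_surj_on[OF bij_lattice_point] by (metis imageE surj_pair)
    then show "c l = 0"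
      using zero[of 1 \<beta> \<omega>] zero[of "-1" \<beta> \<omega>] by (auto intro: bimodule_proj_eq_0_imp)
  qed
qed

end
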